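(* Let $V_t\big(\Pi_t(\Delta_t,\Lambda_t^{1:K})\big)$ be functions defined recursively for all $\mathbf g\in\mathcal G^s$ by $$V_T\big(\Pi_T(\Delta_T,\Lambda_T^{1:K})\big):=\mathbb E^{\mathbf g}\big[c_T(X_T)\mid\Pi_T=\pi_T\big],$$ $$V_t\big(\Pi_t(\Delta_t,\Lambda_t^{1:K})\big):=\inf_{u_t^{1:K}\in\prod_{k\in\mathcal K}\mathcal U_t^k}\mathbb E^{\mathbf g}\Big[c_t(X_t,U_t^{1:K})+V_{t+1}\big(\theta_t[\Pi_t(\Delta_t,\Lambda_t^{1:K}),Y_{t+1}^{1:K},U_t^{1:K}]\big)\,\Big|\,\Pi_t=\pi_t,\,U_t^{1:K}=u_t^{1:K}\Big],$$ for $t=T-1,\dots,0$, where $\pi_T,\pi_t,u_t^{1:K}$ are the realizations of $\Pi_T,\Pi_t,U_t^{1:K}$, respectively. Then, for any control strategy $\mathbf g\in\mathcal G$ (and all $t=0,\dots,T$), $$V_t\big(\Pi_t(\Delta_t,\Lambda_t^{1:K})\big)\le J_t(\mathbf g):=\mathbb E^{\mathbf g}\Big[\sum_{l=t}^{T-1}c_l(X_l,U_l^{1:K})+c_T(X_T)\,\Big|\,\Delta_t,\Lambda_t^{1:K}\Big],$$ where $J_t(\mathbf g)$ is the cost-to-go of the team at time $t$ corresponding to the control strategy $\mathbf g\in\mathcal G$.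
   Context: Model. $K,T\in\mathbb N$, $\mathcal K=\{1,\dots,K\}$; all random variables are defined on a probability space $(\Omega,\mathscr F,\mathbb P)$. The state $X_t$ takes values in a measurable space $(\mathcal X_t,\mathscr X_t)$, $t=0,\dots,T$; the decision $U_t^k$ of member $k\in\mathcal K$ takes values in a measurable space $(\mathcal U_t^k,\mathscr U_t^k)$ with $\mathcal U_t^k\neq\emptyset$, $t=0,\dots,T-1$. The state evolves by $X_{t+1}=f_t(X_t,U_t^{1:K},W_t)$, and member $k$ observes $Y_t^k=h_t^k(X_t,Z_t^k)$ with values in $(\mathcal Y^k,\mathscr Y^k)$. $\{W_t\}$ is a sequence of independent random variables, independent of $X_0$; $\{Z_t^k\}_{t,k}$ are independent random variables, independent of $X_0$ and of $\{W_t\}$. The costs $c_t:\mathcal X_t\times\prod_k\mathcal U_t^k\to\mathbb R$ ($t<T$) and $c_T:\mathcal X_T\to\mathbb R$ are measurable. Notation. $A^{1:K}=(A^1,\dots,A^K)$ and $A_{s:t}=(A_s,\dots,A_t)$ (negative time indices are omitted). Information structure ($n$-step delayed sharing, $n\ge 1$ an integer). $\Delta_t=(Y_{0:t-n}^{1:K},U_{0:t-n}^{1:K})$ is known to all members; $\Lambda_t^k=(Y_{t-n+1:t}^k,U_{t-n+1:t-1}^k)$ is known only to member $k$. These take values in measurable spaces $(\mathcal D_t,\mathscr D_t)$ and $(\mathcal L_t^k,\mathscr L_t^k)$. Strategies. $\mathcal G$ is the set of centralized strategies $\mathbf g=\{g_t\}_{t=0}^{T-1}$, where $g_t$ is a measurable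 map from $\mathcal L_t^1\times\dots\times\mathcal L_t^K\times\mathcal D_t$ to $\prod_{k}\mathcal U_t^k$ and $U_t^{1:K}=g_t(\Lambda_t^{1:K},\Delta_t)$. Densities. All probability distributions are assumed to have (conditional) densities $p$. A superscript $\mathbf g$ indicates that the quantity is computed under strategy $\mathbf g$; absence of the superscript indicates that it does not depend on the choice of $\mathbf g$. Information state. $\Pi_t=\Pi_t(\Delta_t,\Lambda_t^{1:K})$ is the conditional density $p(X_t=\cdot\mid\Delta_t,\Lambda_t^{1:K})$ on $\mathcal X_t$ (it does not depend on $\mathbf g$). The update map $\theta_t$, satisfying $\Pi_{t+1}=\theta_t[\Pi_t,Y_{t+1}^{1:K},U_t^{1:K}]$, is $$\theta_t[\pi,y,u](x')=\frac{p(Y_{t+1}^{1:K}=y\mid X_{t+1}=x')\int_{\mathcal X_t}p(X_{t+1}=x'\mid X_t=x,U_t^{1:K}=u)\,\pi(x)\,dx}{\int_{\mathcal X_{t+1}}p(Y_{t+1}^{1:K}=y\mid X_{t+1}=x'')\int_{\mathcal X_t}p(X_{t+1}=x''\mid X_t=x,U_t^{1:K}=u)\,\pi(x)\,dx\,dx''}.$$ Separated strategies. $\mathbf g\in\mathcal G$ is separated if $g_t$ depends on $(\Delta_t,\Lambda_t^{1:K})$ only through the information state, i.e., $U_t^{1:K}=g_t(\Pi_t(\Delta_t,\Lambda_t^{1:K}))$; $\mathcal G^s\subseteq\mathcal G$ is the set of separated strategies. *)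

theory Defs
  imports "HOL-Probability.Probability"
begin

text \<open>
  The data of a decentralised stochastic control problem with \<open>delay\<close>-step delayed sharing.
  The members are \<open>1, \<dots>, members\<close>; a tuple over the members is an extensional function on
  this index set.  The spaces may depend on time and member, so each of them is a measure
  space carved out of one ambient type.  The measures carried by \<open>state_space\<close> and
  \<open>obs_space\<close> are the reference measures of the densities; for the other spaces only the
  sigma-algebra is relevant.

  \<open>trans_dens t x u x'\<close> is the density of \<open>X\<^sub>t\<^sub>+\<^sub>1\<close> at \<open>x'\<close> given \<open>X\<^sub>t = x\<close>, \<open>U\<^sub>t = u\<close>, and
  \<open>obs_dens t x y\<close> is the density of \<open>Y\<^sub>t\<close> (all members jointly) at \<open>y\<close> given \<open>X\<^sub>t = x\<close>.
\<close>

record ('a, 'x, 'u, 'y, 'w, 'z) team =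
  sample :: "'a measure"
  members :: nat
  horizon :: nat
  delay :: nat
  state_space :: "nat \<Rightarrow> 'x measure"
  control_space :: "nat \<Rightarrow> nat \<Rightarrow> 'u measure"
  obs_space :: "nat \<Rightarrow> 'y measure"
  noise_space :: "nat \<Rightarrow> 'w measure"
  sensor_space :: "nat \<Rightarrow> nat \<Rightarrow> 'z measure"
  init :: "'a \<Rightarrow> 'x"
  noise :: "nat \<Rightarrow> 'a \<Rightarrow> 'w"
  sensor :: "nat \<Rightarrow> nat \<Rightarrow> 'a \<Rightarrow> 'z"
  dynamics :: "nat \<Rightarrow> 'x \<Rightarrow> (nat \<Rightarrow> 'u) \<Rightarrow> 'w \<Rightarrow> 'x"
  observe :: "nat \<Rightarrow> nat \<Rightarrow> 'x \<Rightarrow> 'z \<Rightarrow> 'y"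
  stage_cost :: "nat \<Rightarrow> 'x \<Rightarrow> (nat \<Rightarrow> 'u) \<Rightarrow> real"
  final_cost :: "'x \<Rightarrow> real"
  trans_dens :: "nat \<Rightarrow> 'x \<Rightarrow> (nat \<Rightarrow> 'u) \<Rightarrow> 'x \<Rightarrow> ennreal"
  obs_dens :: "nat \<Rightarrow> 'x \<Rightarrow> (nat \<Rightarrow> 'y) \<Rightarrow> ennreal"

definition controls :: "('a, 'x, 'u, 'y, 'w, 'z) team \<Rightarrow> nat \<Rightarrow> (nat \<Rightarrow> 'u) measure" where
  "controls S t = PiM {1..members S} (control_space S t)"

definition measurements :: "('a, 'x, 'u, 'y, 'w, 'z) team \<Rightarrow> (nat \<Rightarrow> 'y) measure" where
  "measurements S = PiM {1..members S} (obs_space S)"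

definition obs :: "('a, 'x, 'u, 'y, 'w, 'z) team \<Rightarrow> nat \<Rightarrow> 'x \<Rightarrow> 'a \<Rightarrow> nat \<Rightarrow> 'y" where
  "obs S t x \<omega> = (\<lambda>k\<in>{1..members S}. observe S t k x (sensor S t k \<omega>))"

datatype source = Initial | Plant nat | Sensor nat nat

definition sources :: "('a, 'x, 'u, 'y, 'w, 'z) team \<Rightarrow> source set" where
  "sources S = insert Initial (Plant ` {..<horizon S} \<union>
     (\<lambda>(t, k). Sensor t k) ` ({..horizon S} \<times> {1..members S}))"

text \<open>The primitive random variables have different codomains, so their independence is
  expressed through the sigma-algebras which they generate.\<close>

primrec source_events :: "('a, 'x, 'u, 'y, 'w, 'z) team \<Rightarrow> source \<Rightarrow> 'a set set" where
  "source_events S Initial =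
     sets (vimage_algebra (space (sample S)) (init S) (state_space S 0))"
| "source_events S (Plant t) =
     sets (vimage_algebra (space (sample S)) (noise S t) (noise_space S t))"
| "source_events S (Sensor t k) =
     sets (vimage_algebra (space (sample S)) (sensor S t k) (sensor_space S t k))"

definition delayed_sharing_team :: "('a, 'x, 'u, 'y, 'w, 'z) team \<Rightarrow> bool" where
  "delayed_sharing_team S \<longleftrightarrow>
     prob_space (sample S) \<and> 1 \<le> delay S \<and>
     (\<forall>t\<le>horizon S. sigma_finite_measure (state_space S t)) \<and>
     (\<forall>k\<in>{1..members S}. sigma_finite_measure (obs_space S k)) \<and>
     (\<forall>t<horizon S. \<forall>k\<in>{1..members S}. space (control_space S t k) \<noteq> {}) \<and>
     \<comment> \<open>primitive random variables\<close>
     init S \<in> sample S \<rightarrow>\<^sub>M state_space S 0 \<and>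
     (\<forall>t<horizon S. noise S t \<in> sample S \<rightarrow>\<^sub>M noise_space S t) \<and>
     (\<forall>t\<le>horizon S. \<forall>k\<in>{1..members S}.
        sensor S t k \<in> sample S \<rightarrow>\<^sub>M sensor_space S t k) \<and>
     prob_space.indep_sets (sample S) (source_events S) (sources S) \<and>
     \<comment> \<open>dynamics, observations and costs\<close>
     (\<forall>t<horizon S. (\<lambda>(x, u, w). dynamics S t x u w)
        \<in> state_space S t \<Otimes>\<^sub>M controls S t \<Otimes>\<^sub>M noise_space S t \<rightarrow>\<^sub>M state_space S (Suc t)) \<and>
     (\<forall>t\<le>horizon S. \<forall>k\<in>{1..members S}. (\<lambda>(x, z). observe S t k x z)
        \<in> state_space S t \<Otimes>\<^sub>M sensor_space S t k \<rightarrow>\<^sub>M obs_space S k) \<and>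
     (\<forall>t<horizon S. (\<lambda>(x, u). stage_cost S t x u)
        \<in> borel_measurable (state_space S t \<Otimes>\<^sub>M controls S t)) \<and>
     final_cost S \<in> borel_measurable (state_space S (horizon S)) \<and>
     \<comment> \<open>conditional densities\<close>
     (\<forall>t<horizon S. (\<lambda>(x, u, x'). trans_dens S t x u x')
        \<in> borel_measurable (state_space S t \<Otimes>\<^sub>M controls S t \<Otimes>\<^sub>M state_space S (Suc t))) \<and>
     (\<forall>t<horizon S. \<forall>x\<in>space (state_space S t). \<forall>u\<in>space (controls S t).
        distributed (sample S) (state_space S (Suc t))
          (\<lambda>\<omega>. dynamics S t x u (noise S t \<omega>)) (trans_dens S t x u)) \<and>
     (\<forall>t\<le>horizon S. (\<lambda>(x, y). obs_dens S t x y)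
        \<in> borel_measurable (state_space S t \<Otimes>\<^sub>M measurements S)) \<and>
     (\<forall>t\<le>horizon S. \<forall>x\<in>space (state_space S t).
        distributed (sample S) (measurements S) (obs S t x) (obs_dens S t x))"

section \<open>Information structure and strategies\<close>

text \<open>\<open>shared_times\<close> is \<open>0:t-n\<close>; \<open>private_obs_times\<close> and \<open>private_control_times\<close> are
  \<open>t-n+1:t\<close> and \<open>t-n+1:t-1\<close>, where negative times are dropped.\<close>

definition shared_times :: "('a, 'x, 'u, 'y, 'w, 'z) team \<Rightarrow> nat \<Rightarrow> nat set" where
  "shared_times S t = {s. s + delay S \<le> t}"

definition private_obs_times :: "('a, 'x, 'u, 'y, 'w, 'z) team \<Rightarrow> nat \<Rightarrow> nat set" where
  "private_obs_times S t = {s. s \<le> t \<and> t < s + delay S}"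

definition private_control_times :: "('a, 'x, 'u, 'y, 'w, 'z) team \<Rightarrow> nat \<Rightarrow> nat set" where
  "private_control_times S t = {s. s < t \<and> t < s + delay S}"

type_synonym ('y, 'u) info =
  "(nat \<Rightarrow> (nat \<Rightarrow> 'y) \<times> (nat \<Rightarrow> 'u)) \<times> ((nat \<Rightarrow> nat \<Rightarrow> 'y) \<times> (nat \<Rightarrow> nat \<Rightarrow> 'u))"

definition shared_space ::
    "('a, 'x, 'u, 'y, 'w, 'z) team \<Rightarrow> nat \<Rightarrow> ((nat \<Rightarrow> nat \<Rightarrow> 'y) \<times> (nat \<Rightarrow> nat \<Rightarrow> 'u)) measure" where
  "shared_space S t =
     PiM (shared_times S t) (\<lambda>_. measurements S) \<Otimes>\<^sub>M PiM (shared_times S t) (controls S)"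

definition private_space ::
    "('a, 'x, 'u, 'y, 'w, 'z) team \<Rightarrow> nat \<Rightarrow> nat \<Rightarrow> ((nat \<Rightarrow> 'y) \<times> (nat \<Rightarrow> 'u)) measure" where
  "private_space S t k =
     PiM (private_obs_times S t) (\<lambda>_. obs_space S k) \<Otimes>\<^sub>M
     PiM (private_control_times S t) (\<lambda>s. control_space S s k)"

definition info_space :: "('a, 'x, 'u, 'y, 'w, 'z) team \<Rightarrow> nat \<Rightarrow> ('y, 'u) info measure" where
  "info_space S t = PiM {1..members S} (private_space S t) \<Otimes>\<^sub>M shared_space S t"

definition shared_info :: "('a, 'x, 'u, 'y, 'w, 'z) team \<Rightarrow> nat \<Rightarrow>
    (nat \<Rightarrow> nat \<Rightarrow> 'y) \<Rightarrow> (nat \<Rightarrow> nat \<Rightarrow> 'u) \<Rightarrow> (nat \<Rightarrow> nat \<Rightarrow> 'y) \<times> (nat \<Rightarrow> nat \<Rightarrow> 'u)" where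
  "shared_info S t y u = (restrict y (shared_times S t), restrict u (shared_times S t))"

definition private_info :: "('a, 'x, 'u, 'y, 'w, 'z) team \<Rightarrow> nat \<Rightarrow> nat \<Rightarrow>
    (nat \<Rightarrow> nat \<Rightarrow> 'y) \<Rightarrow> (nat \<Rightarrow> nat \<Rightarrow> 'u) \<Rightarrow> (nat \<Rightarrow> 'y) \<times> (nat \<Rightarrow> 'u)" where
  "private_info S t k y u =
     ((\<lambda>s\<in>private_obs_times S t. y s k), (\<lambda>s\<in>private_control_times S t. u s k))"

definition all_info :: "('a, 'x, 'u, 'y, 'w, 'z) team \<Rightarrow> nat \<Rightarrow>
    (nat \<Rightarrow> nat \<Rightarrow> 'y) \<Rightarrow> (nat \<Rightarrow> nat \<Rightarrow> 'u) \<Rightarrow> ('y, 'u) info" where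
  "all_info S t y u = ((\<lambda>k\<in>{1..members S}. private_info S t k y u), shared_info S t y u)"

type_synonym ('y, 'u) strategy = "nat \<Rightarrow> ('y, 'u) info \<Rightarrow> nat \<Rightarrow> 'u"

definition strategies :: "('a, 'x, 'u, 'y, 'w, 'z) team \<Rightarrow> ('y, 'u) strategy set" where
  "strategies S = {g. \<forall>t<horizon S. g t \<in> info_space S t \<rightarrow>\<^sub>M controls S t}"

section \<open>Closed loop\<close>

text \<open>\<open>run S g t \<omega>\<close> consists of the state at time \<open>t\<close>, the observations at times \<open>0:t\<close>
  and the decisions at times \<open>0:t-1\<close> under the strategy \<open>g\<close>.\<close>

primrec run :: "('a, 'x, 'u, 'y, 'w, 'z) team \<Rightarrow> ('y, 'u) strategy \<Rightarrow> nat \<Rightarrow> 'a \<Rightarrow>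
    'x \<times> (nat \<Rightarrow> nat \<Rightarrow> 'y) \<times> (nat \<Rightarrow> nat \<Rightarrow> 'u)" where
  "run S g 0 \<omega> = (init S \<omega>, (\<lambda>_. undefined)(0 := obs S 0 (init S \<omega>) \<omega>), \<lambda>_. undefined)"
| "run S g (Suc t) \<omega> =
     (let (x, y, u) = run S g t \<omega>;
          ut = g t (all_info S t y u);
          x' = dynamics S t x ut (noise S t \<omega>)
      in (x', y(Suc t := obs S (Suc t) x' \<omega>), u(t := ut)))"

definition state :: "('a, 'x, 'u, 'y, 'w, 'z) team \<Rightarrow> ('y, 'u) strategy \<Rightarrow> nat \<Rightarrow> 'a \<Rightarrow> 'x" where
  "state S g t \<omega> = fst (run S g t \<omega>)"

definition info :: "('a, 'x, 'u, 'y, 'w, 'z) team \<Rightarrow> ('y, 'u) strategy \<Rightarrow> nat \<Rightarrow> 'a \<Rightarrow>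
    ('y, 'u) info" where
  "info S g t \<omega> = all_info S t (fst (snd (run S g t \<omega>))) (snd (snd (run S g t \<omega>)))"

definition measurement :: "('a, 'x, 'u, 'y, 'w, 'z) team \<Rightarrow> ('y, 'u) strategy \<Rightarrow> nat \<Rightarrow> 'a \<Rightarrow>
    nat \<Rightarrow> 'y" where
  "measurement S g t \<omega> = obs S t (state S g t \<omega>) \<omega>"

definition control :: "('a, 'x, 'u, 'y, 'w, 'z) team \<Rightarrow> ('y, 'u) strategy \<Rightarrow> nat \<Rightarrow> 'a \<Rightarrow>
    nat \<Rightarrow> 'u" where
  "control S g t \<omega> = g t (info S g t \<omega>)"

lemma state_0: "state S g 0 \<omega> = init S \<omega>"
  by (simp add: state_def)

lemma state_Suc:
  "state S g (Suc t) \<omega> = dynamics S t (state S g t \<omega>) (control S g t \<omega>) (noise S t \<omega>)"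
  by (simp add: state_def control_def info_def Let_def split: prod.split)

lemma run_observations: "s \<le> t \<Longrightarrow> fst (snd (run S g t \<omega>)) s = measurement S g s \<omega>"
proof (induction t)
  case 0
  then show ?case by (simp add: measurement_def state_def)
next
  case (Suc t)
  show ?case
  proof (cases "s = Suc t")
    case True
    then show ?thesis by (simp add: measurement_def state_def Let_def split: prod.split)
  next
    case False
    then show ?thesis using Suc by (auto simp: Let_def split: prod.split)
  qed
qed

lemma run_controls: "s < t \<Longrightarrow> snd (snd (run S g t \<omega>)) s = control S g s \<omega>"
proof (induction t)
  case (Suc t)
  show ?case
  proof (cases "s = t")
    case True
    then show ?thesis by (simp add: control_def info_def Let_def split: prod.split)
  next
    case False
    then show ?thesis using Suc by (auto simp: Let_def split: prod.split)
  qed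
qed simp

lemma info_eq:
  assumes "1 \<le> delay S"
  shows "info S g t \<omega> = all_info S t (\<lambda>s. measurement S g s \<omega>) (\<lambda>s. control S g s \<omega>)"
proof -
  have "s \<le> t" "s < t" if "s \<in> shared_times S t" for s
    using that assms by (auto simp: shared_times_def)
  moreover have "s \<le> t" if "s \<in> private_obs_times S t" for s
    using that by (auto simp: private_obs_times_def)
  moreover have "s < t" if "s \<in> private_control_times S t" for s
    using that by (auto simp: private_control_times_def)
  ultimately show ?thesis
    by (auto simp: info_def all_info_def private_info_def shared_info_def
        run_observations run_controls intro!: restrict_ext)
qed

definition info_algebra :: "('a, 'x, 'u, 'y, 'w, 'z) team \<Rightarrow> ('y, 'u) strategy \<Rightarrow> nat \<Rightarrow>
    'a measure" where
  "info_algebra S g t = vimage_algebra (space (sample S)) (info S g t) (info_space S t)"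

definition cost_to_go :: "('a, 'x, 'u, 'y, 'w, 'z) team \<Rightarrow> ('y, 'u) strategy \<Rightarrow> nat \<Rightarrow>
    'a \<Rightarrow> real" where
  "cost_to_go S g t = real_cond_exp (sample S) (info_algebra S g t)
     (\<lambda>\<omega>. (\<Sum>l\<in>{t..<horizon S}. stage_cost S l (state S g l \<omega>) (control S g l \<omega>))
          + final_cost S (state S g (horizon S) \<omega>))"

section \<open>Information state\<close>

text \<open>A version of the conditional density of the state given the information of all members
  that serves all strategies simultaneously.\<close>

definition information_state :: "('a, 'x, 'u, 'y, 'w, 'z) team \<Rightarrow>
    (nat \<Rightarrow> ('y, 'u) info \<Rightarrow> 'x \<Rightarrow> ennreal) \<Rightarrow> bool" where
  "information_state S \<rho> \<longleftrightarrow> (\<forall>t\<le>horizon S.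
     (\<lambda>(i, x). \<rho> t i x) \<in> borel_measurable (info_space S t \<Otimes>\<^sub>M state_space S t) \<and>
     (\<forall>g\<in>strategies S. \<forall>A\<in>sets (state_space S t). AE \<omega> in sample S.
        nn_cond_exp (sample S) (info_algebra S g t) (\<lambda>\<omega>. indicator A (state S g t \<omega>)) \<omega>
          = (\<integral>\<^sup>+x\<in>A. \<rho> t (info S g t \<omega>) x \<partial>state_space S t)))"

definition update :: "('a, 'x, 'u, 'y, 'w, 'z) team \<Rightarrow> nat \<Rightarrow> ('x \<Rightarrow> ennreal) \<Rightarrow>
    (nat \<Rightarrow> 'y) \<Rightarrow> (nat \<Rightarrow> 'u) \<Rightarrow> 'x \<Rightarrow> ennreal" where
  "update S t \<pi> y u x' =
     obs_dens S (Suc t) x' y * (\<integral>\<^sup>+x. trans_dens S t x u x' * \<pi> x \<partial>state_space S t) /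
     (\<integral>\<^sup>+x''. obs_dens S (Suc t) x'' y *
        (\<integral>\<^sup>+x. trans_dens S t x u x'' * \<pi> x \<partial>state_space S t) \<partial>state_space S (Suc t))"

text \<open>
  The conditional distribution of \<open>(X\<^sub>t, Y\<^sub>t\<^sub>+\<^sub>1)\<close> given that the information state at time \<open>t\<close>
  is \<open>\<pi>\<close> and the decision is \<open>u\<close>: \<open>X\<^sub>t\<close> has density \<open>\<pi>\<close> and is independent of the noises
  \<open>W\<^sub>t\<close> and \<open>Z\<^sub>t\<^sub>+\<^sub>1\<close>.  It is the same under every strategy,
  and lemma \<open>step_law_cond_exp\<close> below shows that it is a version of the conditional distribution
  under each of them.  A kernel defined for
  every \<open>u\<close> is needed here, because under a separated strategy the decision is a function of the
  information state, so that conditioning on \<open>U\<^sub>t = u\<close> would be conditioning on a null event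
  for all but a few \<open>u\<close>, and arbitrary almost-sure versions cannot be combined under an infimum
  over uncountably many \<open>u\<close>.
\<close>

definition step_law :: "('a, 'x, 'u, 'y, 'w, 'z) team \<Rightarrow> nat \<Rightarrow> ('x \<Rightarrow> ennreal) \<Rightarrow>
    (nat \<Rightarrow> 'u) \<Rightarrow> ('x \<times> (nat \<Rightarrow> 'y)) measure" where
  "step_law S t \<pi> u =
     distr (density (state_space S t) \<pi> \<Otimes>\<^sub>M sample S) (state_space S t \<Otimes>\<^sub>M measurements S)
       (\<lambda>(x, \<omega>). (x, obs S (Suc t) (dynamics S t x u (noise S t \<omega>)) \<omega>))"

text \<open>The expectation of an extended real function.  It agrees with the Lebesgue integral
  whenever that exists, and it is a monotone functional without any measurability or
  integrability assumption, so that infima over uncountably many decisions cause no trouble.\<close>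

definition ext_expectation :: "'b measure \<Rightarrow> ('b \<Rightarrow> ereal) \<Rightarrow> ereal" where
  "ext_expectation M \<phi> =
     enn2ereal (\<integral>\<^sup>+x. e2ennreal (\<phi> x) \<partial>M) - enn2ereal (\<integral>\<^sup>+x. e2ennreal (- \<phi> x) \<partial>M)"

lemma ext_expectation_eq_integral:
  assumes "integrable M f"
  shows "ext_expectation M (\<lambda>x. ereal (f x)) = ereal (integral\<^sup>L M f)"
proof -
  have fin: "(\<integral>\<^sup>+x. ennreal (f x) \<partial>M) < top" "(\<integral>\<^sup>+x. ennreal (- f x) \<partial>M) < top"
    using assms by (auto simp: real_integrable_def top.not_eq_extremum)
  show ?thesis
    unfolding ext_expectation_def real_lebesgue_integral_def[OF assms]
    using fin by (cases "\<integral>\<^sup>+x. ennreal (f x) \<partial>M"; cases "\<integral>\<^sup>+x. ennreal (- f x) \<partial>M")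
      (auto simp: enn2ereal_ennreal)
qed

lemma ext_expectation_mono_AE:
  assumes "AE x in M. \<phi> x \<le> \<psi> x"
  shows "ext_expectation M \<phi> \<le> ext_expectation M \<psi>"
proof -
  have "(\<integral>\<^sup>+x. e2ennreal (\<phi> x) \<partial>M) \<le> (\<integral>\<^sup>+x. e2ennreal (\<psi> x) \<partial>M)"
    by (rule nn_integral_mono_AE) (use assms in \<open>auto intro!: e2ennreal_mono\<close>)
  moreover have "(\<integral>\<^sup>+x. e2ennreal (- \<psi> x) \<partial>M) \<le> (\<integral>\<^sup>+x. e2ennreal (- \<phi> x) \<partial>M)"
    by (rule nn_integral_mono_AE) (use assms in \<open>auto intro!: e2ennreal_mono\<close>)
  ultimately show ?thesis
    unfolding ext_expectation_def by (intro ereal_minus_mono) (auto simp: less_eq_ennreal.rep_eq)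
qed

section \<open>The one-step kernel is a conditional distribution under every strategy\<close>

lemma measurable_obs:
  assumes team: "delayed_sharing_team S" and t: "t \<le> horizon S"
    and x: "x \<in> N \<rightarrow>\<^sub>M state_space S t"
    and z: "\<And>k. k \<in> {1..members S} \<Longrightarrow> (\<lambda>w. sensor S t k (e w)) \<in> N \<rightarrow>\<^sub>M sensor_space S t k"
  shows "(\<lambda>w. obs S t (x w) (e w)) \<in> N \<rightarrow>\<^sub>M measurements S"
  unfolding obs_def measurements_def
proof (rule measurable_restrict)
  fix k assume k: "k \<in> {1..members S}"
  have "(\<lambda>(x, z). observe S t k x z) \<in> state_space S t \<Otimes>\<^sub>M sensor_space S t k \<rightarrow>\<^sub>M obs_space S k"
    using team t k unfolding delayed_sharing_team_def by blast
  from measurable_compose[OF measurable_Pair[OF x z[OF k]] this]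
  show "(\<lambda>w. observe S t k (x w) (sensor S t k (e w))) \<in> N \<rightarrow>\<^sub>M obs_space S k" by simp
qed

lemma measurable_dynamics:
  assumes team: "delayed_sharing_team S" and t: "t < horizon S"
    and x: "x \<in> N \<rightarrow>\<^sub>M state_space S t" and u: "u \<in> N \<rightarrow>\<^sub>M controls S t"
    and w: "w \<in> N \<rightarrow>\<^sub>M noise_space S t"
  shows "(\<lambda>a. dynamics S t (x a) (u a) (w a)) \<in> N \<rightarrow>\<^sub>M state_space S (Suc t)"
proof -
  have "(\<lambda>(x, u, w). dynamics S t x u w)
      \<in> state_space S t \<Otimes>\<^sub>M controls S t \<Otimes>\<^sub>M noise_space S t \<rightarrow>\<^sub>M state_space S (Suc t)"
    using team t unfolding delayed_sharing_team_def by blast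
  from measurable_compose[OF measurable_Pair[OF x measurable_Pair[OF u w]] this]
  show ?thesis by simp
qed

lemma measurable_all_info:
  assumes d: "1 \<le> delay S"
    and y: "\<And>s. s \<le> t \<Longrightarrow> y s \<in> N \<rightarrow>\<^sub>M measurements S"
    and u: "\<And>s. s < t \<Longrightarrow> u s \<in> N \<rightarrow>\<^sub>M controls S s"
  shows "(\<lambda>w. all_info S t (\<lambda>s. y s w) (\<lambda>s. u s w)) \<in> N \<rightarrow>\<^sub>M info_space S t"
proof -
  have sh: "s \<le> t" "s < t" if "s \<in> shared_times S t" for s
    using that d by (auto simp: shared_times_def)
  have yk: "(\<lambda>w. y s w k) \<in> N \<rightarrow>\<^sub>M obs_space S k" if "s \<le> t" "k \<in> {1..members S}" for s k
    using measurable_compose[OF y[OF that(1), unfolded measurements_def]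
        measurable_component_singleton[OF that(2)]] by simp
  have uk: "(\<lambda>w. u s w k) \<in> N \<rightarrow>\<^sub>M control_space S s k" if "s < t" "k \<in> {1..members S}" for s k
    using measurable_compose[OF u[OF that(1), unfolded controls_def]
        measurable_component_singleton[OF that(2)]] by simp
  show ?thesis
    unfolding all_info_def info_space_def shared_space_def private_space_def
      private_info_def shared_info_def
    by (intro measurable_Pair measurable_restrict y u yk uk)
      (auto simp: private_obs_times_def private_control_times_def dest: sh)
qed

lemma closed_loop_measurable:
  assumes team: "delayed_sharing_team S" and g: "g \<in> strategies S"
    and t: "t \<le> horizon S"
    and X0: "init S \<in> N \<rightarrow>\<^sub>M state_space S 0"
    and W: "\<And>s. s < t \<Longrightarrow> noise S s \<in> N \<rightarrow>\<^sub>M noise_space S s"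
    and Z: "\<And>s k. s \<le> t \<Longrightarrow> k \<in> {1..members S} \<Longrightarrow> sensor S s k \<in> N \<rightarrow>\<^sub>M sensor_space S s k"
  shows "state S g t \<in> N \<rightarrow>\<^sub>M state_space S t \<and> measurement S g t \<in> N \<rightarrow>\<^sub>M measurements S
     \<and> info S g t \<in> N \<rightarrow>\<^sub>M info_space S t"
  using t W Z
proof (induction t rule: less_induct)
  case (less t)
  have d: "1 \<le> delay S" using team by (simp add: delayed_sharing_team_def)
  have IH: "state S g s \<in> N \<rightarrow>\<^sub>M state_space S s" "measurement S g s \<in> N \<rightarrow>\<^sub>M measurements S"
     "info S g s \<in> N \<rightarrow>\<^sub>M info_space S s" if "s < t" for s
    using less.IH[OF that] less.prems that by auto
  have U: "control S g s \<in> N \<rightarrow>\<^sub>M controls S s" if "s < t" for s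
  proof -
    have "g s \<in> info_space S s \<rightarrow>\<^sub>M controls S s"
      using g that less.prems(1) by (auto simp: strategies_def)
    from measurable_compose[OF IH(3)[OF that] this] show ?thesis
      by (simp add: control_def[abs_def])
  qed
  have X: "state S g t \<in> N \<rightarrow>\<^sub>M state_space S t"
  proof (cases t)
    case 0
    moreover have "state S g 0 = init S" by (rule ext) (rule state_0)
    ultimately show ?thesis using X0 by simp
  next
    case (Suc s)
    have "(\<lambda>\<omega>. dynamics S s (state S g s \<omega>) (control S g s \<omega>) (noise S s \<omega>))
        \<in> N \<rightarrow>\<^sub>M state_space S (Suc s)"
      by (rule measurable_dynamics[OF team]) (use Suc less.prems IH U in auto)
    then show ?thesis unfolding Suc by (simp add: state_Suc cong: measurable_cong)
  qed
  have Y: "measurement S g t \<in> N \<rightarrow>\<^sub>M measurements S"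
    unfolding measurement_def[abs_def]
    using measurable_obs[OF team less.prems(1) X, of "\<lambda>\<omega>. \<omega>"] less.prems(3) by simp
  have "(\<lambda>\<omega>. all_info S t (\<lambda>s. measurement S g s \<omega>) (\<lambda>s. control S g s \<omega>)) \<in> N \<rightarrow>\<^sub>M info_space S t"
    by (rule measurable_all_info[OF d]) (use IH Y U in \<open>auto simp: le_less\<close>)
  then have "info S g t \<in> N \<rightarrow>\<^sub>M info_space S t"
    by (simp add: info_eq[OF d, abs_def] cong: measurable_cong)
  with X Y show ?case by blast
qed


lemma nn_integral_indep:
  assumes "prob_space M"
    and Np: "space Np = space M" "sets Np \<subseteq> sets M"
    and Nf: "space Nf = space M" "sets Nf \<subseteq> sets M"
    and indep: "\<And>a b. a \<in> sets Np \<Longrightarrow> b \<in> sets Nf \<Longrightarrow>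
        emeasure M (a \<inter> b) = emeasure M a * emeasure M b"
    and \<xi>: "\<xi> \<in> Np \<rightarrow>\<^sub>M A"
    and \<phi>: "\<phi> \<in> borel_measurable (A \<Otimes>\<^sub>M Nf)"
  shows "(\<integral>\<^sup>+\<omega>. \<phi> (\<xi> \<omega>, \<omega>) \<partial>M) = (\<integral>\<^sup>+\<omega>. (\<integral>\<^sup>+\<omega>'. \<phi> (\<xi> \<omega>, \<omega>') \<partial>M) \<partial>M)"
proof -
  interpret prob_space M by fact
  have \<xi>M: "\<xi> \<in> M \<rightarrow>\<^sub>M A" using \<xi> Np by (auto simp: measurable_def)
  have idM: "(\<lambda>\<omega>. \<omega>) \<in> M \<rightarrow>\<^sub>M Nf" using Nf by (auto simp: measurable_def)
  interpret M1: prob_space "distr M A \<xi>" by (rule prob_space_distr[OF \<xi>M])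
  interpret M2: prob_space "distr M Nf (\<lambda>\<omega>. \<omega>)" by (rule prob_space_distr[OF idM])
  have pair: "(\<lambda>\<omega>. (\<xi> \<omega>, \<omega>)) \<in> M \<rightarrow>\<^sub>M A \<Otimes>\<^sub>M Nf" by (rule measurable_Pair[OF \<xi>M idM])
  have eq: "distr M A \<xi> \<Otimes>\<^sub>M distr M Nf (\<lambda>\<omega>. \<omega>) = distr M (A \<Otimes>\<^sub>M Nf) (\<lambda>\<omega>. (\<xi> \<omega>, \<omega>))"
  proof (rule pair_measure_eqI)
    fix a b assume "a \<in> sets (distr M A \<xi>)" "b \<in> sets (distr M Nf (\<lambda>\<omega>. \<omega>))"
    then have ab: "a \<in> sets A" "b \<in> sets Nf" by auto
    have "emeasure (distr M (A \<Otimes>\<^sub>M Nf) (\<lambda>\<omega>. (\<xi> \<omega>, \<omega>))) (a \<times> b) = emeasure M ((\<xi> -` a \<inter> space M) \<inter> b)"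
      using ab pair sets.sets_into_space[OF ab(2)]
      by (subst emeasure_distr) (auto intro!: arg_cong[where f="emeasure M"] simp: Nf)
    also have "\<dots> = emeasure M (\<xi> -` a \<inter> space M) * emeasure M b"
      by (rule indep) (use measurable_sets[OF \<xi> ab(1)] ab Np in auto)
    also have "\<dots> = emeasure (distr M A \<xi>) a * emeasure (distr M Nf (\<lambda>\<omega>. \<omega>)) b"
      using ab \<xi>M idM sets.sets_into_space[OF ab(2)]
      by (simp add: emeasure_distr Nf Int_absorb2)
    finally show "emeasure (distr M A \<xi>) a * emeasure (distr M Nf (\<lambda>\<omega>. \<omega>)) b =
        emeasure (distr M (A \<Otimes>\<^sub>M Nf) (\<lambda>\<omega>. (\<xi> \<omega>, \<omega>))) (a \<times> b)" ..
  qed (auto intro: M1.sigma_finite_measure_axioms M2.sigma_finite_measure_axioms cong: sets_pair_measure_cong)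
  have \<phi>': "\<phi> \<in> borel_measurable (distr M A \<xi> \<Otimes>\<^sub>M distr M Nf (\<lambda>\<omega>. \<omega>))"
    using \<phi> by (simp cong: measurable_cong_sets sets_pair_measure_cong)
  have sec: "(\<lambda>\<omega>'. \<phi> (x, \<omega>')) \<in> borel_measurable Nf" if "x \<in> space A" for x
    by (rule measurable_compose[OF measurable_Pair1'[OF that] \<phi>])
  have "(\<integral>\<^sup>+\<omega>. \<phi> (\<xi> \<omega>, \<omega>) \<partial>M) = (\<integral>\<^sup>+p. \<phi> p \<partial>distr M (A \<Otimes>\<^sub>M Nf) (\<lambda>\<omega>. (\<xi> \<omega>, \<omega>)))"
    by (simp add: nn_integral_distr[OF pair] \<phi>)
  also have "\<dots> = (\<integral>\<^sup>+x. (\<integral>\<^sup>+\<omega>'. \<phi> (x, \<omega>') \<partial>distr M Nf (\<lambda>\<omega>. \<omega>)) \<partial>distr M A \<xi>)"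
    unfolding eq[symmetric] by (rule M2.nn_integral_fst[OF \<phi>', symmetric])
  also have "\<dots> = (\<integral>\<^sup>+\<omega>. (\<integral>\<^sup>+\<omega>'. \<phi> (\<xi> \<omega>, \<omega>') \<partial>distr M Nf (\<lambda>\<omega>. \<omega>)) \<partial>M)"
    by (subst nn_integral_distr[OF \<xi>M])
      (use M2.borel_measurable_nn_integral_fst[OF \<phi>'] in \<open>auto cong: measurable_cong_sets\<close>)
  also have "\<dots> = (\<integral>\<^sup>+\<omega>. (\<integral>\<^sup>+\<omega>'. \<phi> (\<xi> \<omega>, \<omega>') \<partial>M) \<partial>M)"
  proof (rule nn_integral_cong)
    fix \<omega> assume "\<omega> \<in> space M"
    then have "\<xi> \<omega> \<in> space A" using \<xi>M by (auto simp: measurable_def)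
    then show "(\<integral>\<^sup>+\<omega>'. \<phi> (\<xi> \<omega>, \<omega>') \<partial>distr M Nf (\<lambda>\<omega>. \<omega>)) = (\<integral>\<^sup>+\<omega>'. \<phi> (\<xi> \<omega>, \<omega>') \<partial>M)"
      by (simp add: nn_integral_distr[OF idM] sec)
  qed
  finally show ?thesis .
qed

lemma past_future_indep:
  fixes S :: "('a, 'x, 'u, 'y, 'w, 'z) team"
  assumes team: "delayed_sharing_team S" and t: "t < horizon S"
  defines "P \<equiv> insert Initial (Plant ` {..<t} \<union> (\<lambda>(s, k). Sensor s k) ` ({..t} \<times> {1..members S}))"
    and "F \<equiv> insert (Plant t) (Sensor (Suc t) ` {1..members S})"
  shows "\<Union>(source_events S ` P) \<subseteq> sets (sample S)" "\<Union>(source_events S ` F) \<subseteq> sets (sample S)"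
    and "a \<in> sigma_sets (space (sample S)) (\<Union>(source_events S ` P)) \<Longrightarrow>
      b \<in> sigma_sets (space (sample S)) (\<Union>(source_events S ` F)) \<Longrightarrow>
      emeasure (sample S) (a \<inter> b) = emeasure (sample S) a * emeasure (sample S) b"
proof -
  have "prob_space (sample S)" using team by (simp add: delayed_sharing_team_def)
  then interpret prob_space "sample S" .
  have ind: "indep_sets (source_events S) (sources S)"
    using team by (simp add: delayed_sharing_team_def)
  have sub: "P \<union> F \<subseteq> sources S" using t by (auto simp: P_def F_def sources_def)
  show PE: "\<Union>(source_events S ` P) \<subseteq> sets (sample S)" "\<Union>(source_events S ` F) \<subseteq> sets (sample S)"
  proof -
    have "source_events S j \<subseteq> sets (sample S)" if "j \<in> P \<union> F" for j
      using ind sub that unfolding indep_sets_def by blast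
    then show "\<Union>(source_events S ` P) \<subseteq> sets (sample S)" "\<Union>(source_events S ` F) \<subseteq> sets (sample S)"
      by blast+
  qed
  have int: "Int_stable (source_events S j)" for j by (cases j) (auto intro: sets.Int_stable)
  have "indep_sets (\<lambda>j. sigma_sets (space (sample S)) (\<Union>i\<in>case_bool P F j. source_events S i)) UNIV"
  proof (rule indep_sets_collect_sigma)
    have "(\<Union>j\<in>UNIV. case_bool P F j) = P \<union> F" by (auto simp: UNIV_bool)
    then show "indep_sets (source_events S) (\<Union>j\<in>UNIV. case_bool P F j)"
      using indep_sets_mono_index[OF sub ind] by simp
    show "disjoint_family_on (case_bool P F) UNIV"
      by (auto simp: disjoint_family_on_def P_def F_def split: bool.split)
  qed (use int in auto)
  then have "indep_set (sigma_sets (space (sample S)) (\<Union>(source_events S ` P)))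
     (sigma_sets (space (sample S)) (\<Union>(source_events S ` F)))"
    unfolding indep_set_def by (rule indep_sets_cong[THEN iffD1, rotated -1]) (auto split: bool.split)
  from indep_setD[OF this] indep_setD_ev1[OF this] indep_setD_ev2[OF this]
  show "a \<in> sigma_sets (space (sample S)) (\<Union>(source_events S ` P)) \<Longrightarrow>
      b \<in> sigma_sets (space (sample S)) (\<Union>(source_events S ` F)) \<Longrightarrow>
      emeasure (sample S) (a \<inter> b) = emeasure (sample S) a * emeasure (sample S) b"
    by (simp add: emeasure_eq_measure ennreal_mult'')
qed

lemma information_state_disintegration:
  assumes team: "delayed_sharing_team S" and \<rho>: "information_state S \<rho>"
    and g: "g \<in> strategies S" and t: "t \<le> horizon S"
    and \<psi>: "\<psi> \<in> borel_measurable (info_space S t \<Otimes>\<^sub>M state_space S t)"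
  shows "(\<integral>\<^sup>+\<omega>. \<psi> (info S g t \<omega>, state S g t \<omega>) \<partial>sample S) =
     (\<integral>\<^sup>+\<omega>. (\<integral>\<^sup>+x. \<rho> t (info S g t \<omega>) x * \<psi> (info S g t \<omega>, x) \<partial>state_space S t) \<partial>sample S)"
proof -
  let ?M = "sample S" and ?I = "info S g t" and ?X = "state S g t"
  let ?A = "info_space S t" and ?B = "state_space S t"
  interpret prob_space ?M using team by (simp add: delayed_sharing_team_def)
  interpret B: sigma_finite_measure ?B using team t by (simp add: delayed_sharing_team_def)
  have [measurable]: "?I \<in> ?M \<rightarrow>\<^sub>M ?A" "?X \<in> ?M \<rightarrow>\<^sub>M ?B"
    using closed_loop_measurable[OF team g t, of ?M] team t by (auto simp: delayed_sharing_team_def)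
  have F: "subalgebra ?M (info_algebra S g t)"
    unfolding subalgebra_def info_algebra_def by (simp add: sets_image_in_sets)
  interpret finite_measure_subalgebra ?M "info_algebra S g t"
    by unfold_locales (rule F)
  have [measurable]: "?I \<in> info_algebra S g t \<rightarrow>\<^sub>M ?A"
    unfolding info_algebra_def by (rule measurable_vimage_algebra1) (auto intro: measurable_space)
  have [measurable]: "(\<lambda>(i, x). \<rho> t i x) \<in> borel_measurable (?A \<Otimes>\<^sub>M ?B)"
    using \<rho> t by (simp add: information_state_def)
  let ?D = "density (distr ?M ?A ?I \<Otimes>\<^sub>M ?B) (\<lambda>(i, x). \<rho> t i x)"
  have eq: "distr ?M (?A \<Otimes>\<^sub>M ?B) (\<lambda>\<omega>. (?I \<omega>, ?X \<omega>)) = ?D"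
  proof (rule measure_eqI_generator_eq[OF Int_stable_pair_measure_generator pair_measure_closed])
    fix C assume "C \<in> {a \<times> b |a b. a \<in> sets ?A \<and> b \<in> sets ?B}"
    then obtain a b where C: "C = a \<times> b" and [measurable]: "a \<in> sets ?A" "b \<in> sets ?B" by auto
    have ae: "AE \<omega> in ?M. nn_cond_exp ?M (info_algebra S g t) (\<lambda>\<omega>. indicator b (?X \<omega>)) \<omega>
          = (\<integral>\<^sup>+x\<in>b. \<rho> t (?I \<omega>) x \<partial>?B)"
      using \<rho> t g by (simp add: information_state_def)
    have "emeasure (distr ?M (?A \<Otimes>\<^sub>M ?B) (\<lambda>\<omega>. (?I \<omega>, ?X \<omega>))) C
        = (\<integral>\<^sup>+p. indicator C p \<partial>distr ?M (?A \<Otimes>\<^sub>M ?B) (\<lambda>\<omega>. (?I \<omega>, ?X \<omega>)))"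
      by (simp add: C)
    also have "\<dots> = (\<integral>\<^sup>+\<omega>. indicator C (?I \<omega>, ?X \<omega>) \<partial>?M)"
      by (subst nn_integral_distr) (auto simp: C)
    also have "\<dots> = (\<integral>\<^sup>+\<omega>. indicator a (?I \<omega>) * indicator b (?X \<omega>) \<partial>?M)"
      by (auto intro!: nn_integral_cong simp: C indicator_def)
    also have "\<dots> = (\<integral>\<^sup>+\<omega>. indicator a (?I \<omega>) *
        nn_cond_exp ?M (info_algebra S g t) (\<lambda>\<omega>. indicator b (?X \<omega>)) \<omega> \<partial>?M)"
      by (rule nn_cond_exp_intg[symmetric]) auto
    also have "\<dots> = (\<integral>\<^sup>+\<omega>. indicator a (?I \<omega>) * (\<integral>\<^sup>+x\<in>b. \<rho> t (?I \<omega>) x \<partial>?B) \<partial>?M)"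
      by (rule nn_integral_cong_AE) (use ae in auto)
    also have "\<dots> = (\<integral>\<^sup>+\<omega>. (\<integral>\<^sup>+x. \<rho> t (?I \<omega>) x * indicator C (?I \<omega>, x) \<partial>?B) \<partial>?M)"
      by (auto intro!: nn_integral_cong simp: C indicator_def)
    also have "\<dots> = (\<integral>\<^sup>+i. (\<integral>\<^sup>+x. \<rho> t i x * indicator C (i, x) \<partial>?B) \<partial>distr ?M ?A ?I)"
      by (subst nn_integral_distr) (auto simp: C)
    also have "\<dots> = emeasure ?D C"
      by (subst emeasure_density) (auto simp: C B.nn_integral_fst[symmetric])
    finally show "emeasure (distr ?M (?A \<Otimes>\<^sub>M ?B) (\<lambda>\<omega>. (?I \<omega>, ?X \<omega>))) C = emeasure ?D C" .
  next
    show "sets (distr ?M (?A \<Otimes>\<^sub>M ?B) (\<lambda>\<omega>. (?I \<omega>, ?X \<omega>))) =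
        sigma_sets (space ?A \<times> space ?B) {a \<times> b |a b. a \<in> sets ?A \<and> b \<in> sets ?B}"
      by (simp add: sets_pair_measure)
    show "sets ?D = sigma_sets (space ?A \<times> space ?B) {a \<times> b |a b. a \<in> sets ?A \<and> b \<in> sets ?B}"
      by (simp add: sets_pair_measure)
    show "range (\<lambda>_::nat. space ?A \<times> space ?B) \<subseteq> {a \<times> b |a b. a \<in> sets ?A \<and> b \<in> sets ?B}"
      by auto
    fix i :: nat
    interpret D: prob_space "distr ?M (?A \<Otimes>\<^sub>M ?B) (\<lambda>\<omega>. (?I \<omega>, ?X \<omega>))"
      by (rule prob_space_distr) measurable
    show "emeasure (distr ?M (?A \<Otimes>\<^sub>M ?B) (\<lambda>\<omega>. (?I \<omega>, ?X \<omega>))) (space ?A \<times> space ?B) \<noteq> \<infinity>"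
      by (simp add: D.emeasure_finite)
  qed auto
  note [measurable] = \<psi>
  have "(\<integral>\<^sup>+\<omega>. \<psi> (?I \<omega>, ?X \<omega>) \<partial>?M) = (\<integral>\<^sup>+p. \<psi> p \<partial>?D)"
    unfolding eq[symmetric] by (subst nn_integral_distr) auto
  also have "\<dots> = (\<integral>\<^sup>+p. (case p of (i, x) \<Rightarrow> \<rho> t i x) * \<psi> p \<partial>(distr ?M ?A ?I \<Otimes>\<^sub>M ?B))"
    by (subst nn_integral_density) auto
  also have "\<dots> = (\<integral>\<^sup>+i. (\<integral>\<^sup>+x. \<rho> t i x * \<psi> (i, x) \<partial>?B) \<partial>distr ?M ?A ?I)"
    by (subst B.nn_integral_fst[symmetric]) auto
  also have "\<dots> = (\<integral>\<^sup>+\<omega>. (\<integral>\<^sup>+x. \<rho> t (?I \<omega>) x * \<psi> (?I \<omega>, x) \<partial>?B) \<partial>?M)"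
    by (subst nn_integral_distr) auto
  finally show ?thesis .
qed


lemma step_law_cond_exp:
  assumes team: "delayed_sharing_team S" and \<rho>: "information_state S \<rho>"
    and g: "g \<in> strategies S" and t: "t < horizon S"
    and \<phi>: "\<phi> \<in> borel_measurable (state_space S t \<Otimes>\<^sub>M measurements S)"
  shows "AE \<omega> in sample S.
     (\<integral>\<^sup>+z. \<phi> z \<partial>step_law S t (\<rho> t (info S g t \<omega>)) (control S g t \<omega>)) =
     nn_cond_exp (sample S) (info_algebra S g t)
       (\<lambda>\<omega>. \<phi> (state S g t \<omega>, measurement S g (Suc t) \<omega>)) \<omega>"
proof -
  let ?M = "sample S" and ?I = "info S g t" and ?X = "state S g t"
  let ?A = "info_space S t" and ?B = "state_space S t"
  let ?P = "insert Initial (Plant ` {..<t} \<union> (\<lambda>(s, k). Sensor s k) ` ({..t} \<times> {1..members S}))"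
  let ?F = "insert (Plant t) (Sensor (Suc t) ` {1..members S})"
  let ?Np = "sigma (space ?M) (\<Union>(source_events S ` ?P))"
  let ?Nf = "sigma (space ?M) (\<Union>(source_events S ` ?F))"
  interpret prob_space ?M using team by (simp add: delayed_sharing_team_def)
  interpret B: sigma_finite_measure ?B using team t by (simp add: delayed_sharing_team_def)
  note indep = past_future_indep[OF team t]
  have powP: "\<Union>(source_events S ` ?P) \<subseteq> Pow (space ?M)"
    using indep(1) sets.space_closed by (rule order_trans)
  have powF: "\<Union>(source_events S ` ?F) \<subseteq> Pow (space ?M)"
    using indep(2) sets.space_closed by (rule order_trans)
  have Np: "space ?Np = space ?M" "sets ?Np \<subseteq> sets ?M"
    using indep(1) powP by (simp_all add: sets.sigma_sets_subset)
  have Nf: "space ?Nf = space ?M" "sets ?Nf \<subseteq> sets ?M"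
    using indep(2) powF by (simp_all add: sets.sigma_sets_subset)
  have ind: "emeasure ?M (a \<inter> b) = emeasure ?M a * emeasure ?M b"
    if "a \<in> sets ?Np" "b \<in> sets ?Nf" for a b
    using indep(3)[of a b] that powP powF by simp
  have gen: "X \<in> N \<rightarrow>\<^sub>M K"
    if "X \<in> ?M \<rightarrow>\<^sub>M K" "space N = space ?M" "sets (vimage_algebra (space ?M) X K) \<subseteq> sets N"
    for X N K
    using that by (subst measurable_iff_sets) (auto simp: measurable_def)
  have inN: "source_events S j \<subseteq> sets (sigma (space ?M) (\<Union>(source_events S ` J)))"
    if "j \<in> J" "\<Union>(source_events S ` J) \<subseteq> Pow (space ?M)" for j J
    using that by (auto intro: sigma_sets.Basic)
  have X0: "init S \<in> ?Np \<rightarrow>\<^sub>M state_space S 0"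
    by (rule gen) (use team inN[OF _ powP, of Initial] powP in \<open>auto simp: delayed_sharing_team_def\<close>)
  have W: "noise S s \<in> ?Np \<rightarrow>\<^sub>M noise_space S s" if "s < t" for s
    by (rule gen) (use team t that inN[OF _ powP, of "Plant s"] powP in \<open>auto simp: delayed_sharing_team_def\<close>)
  have Z: "sensor S s k \<in> ?Np \<rightarrow>\<^sub>M sensor_space S s k" if "s \<le> t" "k \<in> {1..members S}" for s k
  proof (rule gen)
    have "Sensor s k \<in> ?P" using that by force
    from inN[OF this powP] show "sets (vimage_algebra (space ?M) (sensor S s k) (sensor_space S s k)) \<subseteq> sets ?Np"
      by simp
  qed (use team t that powP in \<open>auto simp: delayed_sharing_team_def\<close>)
  have Wf: "noise S t \<in> ?Nf \<rightarrow>\<^sub>M noise_space S t"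
    by (rule gen) (use team t inN[OF _ powF, of "Plant t"] powF in \<open>auto simp: delayed_sharing_team_def\<close>)
  have Zf: "sensor S (Suc t) k \<in> ?Nf \<rightarrow>\<^sub>M sensor_space S (Suc t) k" if "k \<in> {1..members S}" for k
  proof (rule gen)
    have "Sensor (Suc t) k \<in> ?F" using that by force
    from inN[OF this powF]
    show "sets (vimage_algebra (space ?M) (sensor S (Suc t) k) (sensor_space S (Suc t) k)) \<subseteq> sets ?Nf"
      by simp
  qed (use team t that powF in \<open>auto simp: delayed_sharing_team_def\<close>)
  have XI: "?X \<in> ?Np \<rightarrow>\<^sub>M ?B" "?I \<in> ?Np \<rightarrow>\<^sub>M ?A"
    using closed_loop_measurable[OF team g _ X0 W Z] t by auto
  have sub: "f \<in> ?Np \<rightarrow>\<^sub>M K \<Longrightarrow> f \<in> ?M \<rightarrow>\<^sub>M K" for f K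
    using Np by (auto simp: measurable_def)
  have XM[measurable]: "?X \<in> ?M \<rightarrow>\<^sub>M ?B" "?I \<in> ?M \<rightarrow>\<^sub>M ?A"
    using XI[THEN sub] by auto
  have gt[measurable]: "g t \<in> ?A \<rightarrow>\<^sub>M controls S t" using g t by (auto simp: strategies_def)
  define \<zeta> where "\<zeta> = (\<lambda>x u \<omega>. obs S (Suc t) (dynamics S t x u (noise S t \<omega>)) \<omega>)"
  have \<zeta>: "(\<lambda>a. \<zeta> (x a) (u a) (e a)) \<in> N \<rightarrow>\<^sub>M measurements S"
    if "x \<in> N \<rightarrow>\<^sub>M ?B" "u \<in> N \<rightarrow>\<^sub>M controls S t" "e \<in> N \<rightarrow>\<^sub>M ?Nf" for x u e and N :: "'n measure"
    unfolding \<zeta>_def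
  proof (rule measurable_obs[OF team])
    show "(\<lambda>a. dynamics S t (x a) (u a) (noise S t (e a))) \<in> N \<rightarrow>\<^sub>M state_space S (Suc t)"
      using that by (intro measurable_dynamics[OF team t] measurable_compose[OF _ Wf])
    show "(\<lambda>w. sensor S (Suc t) k (e w)) \<in> N \<rightarrow>\<^sub>M sensor_space S (Suc t) k"
      if "k \<in> {1..members S}" for k
      by (rule measurable_compose[OF \<open>e \<in> N \<rightarrow>\<^sub>M ?Nf\<close> Zf[OF that]])
  qed (use t in simp)
  have idM: "(\<lambda>\<omega>. \<omega>) \<in> ?M \<rightarrow>\<^sub>M ?Nf" using Nf by (auto simp: measurable_def)
  have Y: "measurement S g (Suc t) \<omega> = \<zeta> (?X \<omega>) (g t (?I \<omega>)) \<omega>" for \<omega>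
    by (simp add: measurement_def state_Suc \<zeta>_def control_def)
  define \<psi> where "\<psi> = (\<lambda>(i, x). \<integral>\<^sup>+\<omega>'. \<phi> (x, \<zeta> x (g t i) \<omega>') \<partial>?M)"
  note \<phi>[measurable]
  have mN[measurable]: "(\<lambda>(p, \<omega>'). \<phi> (snd p, \<zeta> (snd p) (g t (fst p)) \<omega>'))
      \<in> borel_measurable ((?A \<Otimes>\<^sub>M ?B) \<Otimes>\<^sub>M ?Nf)"
    unfolding split_beta
    by (intro measurable_compose[OF measurable_Pair \<phi>] \<zeta>) measurable
  have mM: "(\<lambda>(p, \<omega>'). \<phi> (snd p, \<zeta> (snd p) (g t (fst p)) \<omega>'))
      \<in> borel_measurable ((?A \<Otimes>\<^sub>M ?B) \<Otimes>\<^sub>M ?M)"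
    unfolding split_beta
    by (intro measurable_compose[OF measurable_Pair \<phi>] \<zeta> measurable_compose[OF _ idM]) measurable
  have \<psi>M[measurable]: "\<psi> \<in> borel_measurable (?A \<Otimes>\<^sub>M ?B)"
    using borel_measurable_nn_integral_fst[OF mM] by (simp add: \<psi>_def split_beta)
  have \<rho>M[measurable]: "(\<lambda>(i, x). \<rho> t i x) \<in> borel_measurable (?A \<Otimes>\<^sub>M ?B)"
    using \<rho> t by (simp add: information_state_def)
  define Q where "Q = (\<lambda>i. \<integral>\<^sup>+x. \<rho> t i x * \<psi> (i, x) \<partial>?B)"
  have QM[measurable]: "Q \<in> borel_measurable ?A"
    unfolding Q_def by measurable
  have Q: "(\<integral>\<^sup>+z. \<phi> z \<partial>step_law S t (\<rho> t i) (g t i)) = Q i" if i: "i \<in> space ?A" for i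
  proof -
    have [measurable]: "\<rho> t i \<in> borel_measurable ?B"
      using measurable_compose[OF measurable_Pair1'[OF i] \<rho>M] by simp
    have gi: "(\<lambda>_. g t i) \<in> N \<rightarrow>\<^sub>M controls S t" for N :: "'n measure"
      using measurable_space[OF gt i] by simp
    let ?D = "density ?B (\<rho> t i)"
    have m: "(\<lambda>(x, \<omega>). (x, \<zeta> x (g t i) \<omega>)) \<in> ?D \<Otimes>\<^sub>M ?M \<rightarrow>\<^sub>M ?B \<Otimes>\<^sub>M measurements S"
      unfolding split_beta
      by (intro measurable_Pair \<zeta> gi measurable_compose[OF _ idM]) measurable
    have "(\<integral>\<^sup>+z. \<phi> z \<partial>step_law S t (\<rho> t i) (g t i)) =
        (\<integral>\<^sup>+p. \<phi> (fst p, \<zeta> (fst p) (g t i) (snd p)) \<partial>(?D \<Otimes>\<^sub>M ?M))"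
      unfolding step_law_def using m by (subst nn_integral_distr) (auto simp: \<zeta>_def split_beta)
    also have "\<dots> = (\<integral>\<^sup>+x. \<psi> (i, x) \<partial>?D)"
      unfolding \<psi>_def using measurable_compose[OF m \<phi>]
      by (subst nn_integral_fst[symmetric]) (auto simp: split_beta)
    also have "\<dots> = Q i"
      unfolding Q_def using measurable_compose[OF measurable_Pair1'[OF i] \<psi>M]
      by (subst nn_integral_density) auto
    finally show ?thesis .
  qed
  have F: "subalgebra ?M (info_algebra S g t)"
    unfolding subalgebra_def info_algebra_def by (simp add: sets_image_in_sets)
  interpret finite_measure_subalgebra ?M "info_algebra S g t"
    by unfold_locales (rule F)
  have IF[measurable]: "?I \<in> info_algebra S g t \<rightarrow>\<^sub>M ?A"
    unfolding info_algebra_def by (rule measurable_vimage_algebra1) (auto intro: measurable_space)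
  have "AE \<omega> in ?M. Q (?I \<omega>) =
      nn_cond_exp ?M (info_algebra S g t) (\<lambda>\<omega>. \<phi> (?X \<omega>, measurement S g (Suc t) \<omega>)) \<omega>"
  proof (rule nn_cond_exp_charact)
    show "(\<lambda>\<omega>. \<phi> (?X \<omega>, measurement S g (Suc t) \<omega>)) \<in> borel_measurable ?M"
      unfolding Y by (intro measurable_compose[OF measurable_Pair \<phi>] \<zeta> idM) measurable
    fix a assume "a \<in> sets (info_algebra S g t)"
    then obtain b where b[measurable]: "b \<in> sets ?A" and a: "a = ?I -` b \<inter> space ?M"
      using measurable_space[OF XM(2)] unfolding info_algebra_def
      by (subst (asm) sets_vimage_algebra2) auto
    have ia: "indicator a \<omega> = (indicator b (?I \<omega>) :: ennreal)" if "\<omega> \<in> space ?M" for \<omega>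
      using that by (auto simp: a indicator_def)
    have "(\<integral>\<^sup>+\<omega>\<in>a. \<phi> (?X \<omega>, measurement S g (Suc t) \<omega>) \<partial>?M) =
        (\<integral>\<^sup>+\<omega>. \<phi> (?X \<omega>, \<zeta> (?X \<omega>) (g t (?I \<omega>)) \<omega>) * indicator b (?I \<omega>) \<partial>?M)"
      by (intro nn_integral_cong) (simp add: Y ia)
    also have "\<dots> = (\<integral>\<^sup>+\<omega>. (\<integral>\<^sup>+\<omega>'. \<phi> (?X \<omega>, \<zeta> (?X \<omega>) (g t (?I \<omega>)) \<omega>') * indicator b (?I \<omega>) \<partial>?M) \<partial>?M)"
    proof -
      have "(\<lambda>q. (case q of (p, \<omega>') \<Rightarrow> \<phi> (snd p, \<zeta> (snd p) (g t (fst p)) \<omega>')) * indicator b (fst (fst q)))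
          \<in> borel_measurable ((?A \<Otimes>\<^sub>M ?B) \<Otimes>\<^sub>M ?Nf)"
        by (intro borel_measurable_times_ennreal mN) measurable
      from nn_integral_indep[OF prob_space_axioms Np Nf ind measurable_Pair[OF XI(2,1)] this]
      show ?thesis by simp
    qed
    also have "\<dots> = (\<integral>\<^sup>+\<omega>. \<psi> (?I \<omega>, ?X \<omega>) * indicator b (?I \<omega>) \<partial>?M)"
    proof (rule nn_integral_cong)
      fix \<omega> assume w: "\<omega> \<in> space ?M"
      then have "(?I \<omega>, ?X \<omega>) \<in> space (?A \<Otimes>\<^sub>M ?B)"
        using measurable_space[OF XM(1)] measurable_space[OF XM(2)] by (simp add: space_pair_measure)
      from measurable_compose[OF measurable_Pair1'[OF this] mM]
      show "(\<integral>\<^sup>+\<omega>'. \<phi> (?X \<omega>, \<zeta> (?X \<omega>) (g t (?I \<omega>)) \<omega>') * indicator b (?I \<omega>) \<partial>?M) =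
          \<psi> (?I \<omega>, ?X \<omega>) * indicator b (?I \<omega>)"
        by (simp add: \<psi>_def nn_integral_multc)
    qed
    also have "\<dots> = (\<integral>\<^sup>+\<omega>. (\<integral>\<^sup>+x. \<rho> t (?I \<omega>) x * (\<psi> (?I \<omega>, x) * indicator b (?I \<omega>)) \<partial>?B) \<partial>?M)"
      using information_state_disintegration[OF team \<rho> g, of t "\<lambda>p. \<psi> p * indicator b (fst p)"] t
      by simp
    also have "\<dots> = (\<integral>\<^sup>+\<omega>\<in>a. Q (?I \<omega>) \<partial>?M)"
    proof (rule nn_integral_cong)
      fix \<omega> assume w: "\<omega> \<in> space ?M"
      then have i: "?I \<omega> \<in> space ?A" using measurable_space[OF XM(2)] by simp
      have [measurable]: "\<rho> t (?I \<omega>) \<in> borel_measurable ?B"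
        using measurable_compose[OF measurable_Pair1'[OF i] \<rho>M] by simp
      have [measurable]: "(\<lambda>x. \<psi> (?I \<omega>, x)) \<in> borel_measurable ?B"
        by (rule measurable_compose[OF measurable_Pair1'[OF i] \<psi>M])
      show "(\<integral>\<^sup>+x. \<rho> t (?I \<omega>) x * (\<psi> (?I \<omega>, x) * indicator b (?I \<omega>)) \<partial>?B) = Q (?I \<omega>) * indicator a \<omega>"
        unfolding Q_def ia[OF w] by (subst nn_integral_multc[symmetric]) (auto simp: mult.assoc)
    qed
    finally show "(\<integral>\<^sup>+\<omega>\<in>a. \<phi> (?X \<omega>, measurement S g (Suc t) \<omega>) \<partial>?M) = (\<integral>\<^sup>+\<omega>\<in>a. Q (?I \<omega>) \<partial>?M)" .
  qed (rule measurable_compose[OF IF QM])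
  moreover have "AE \<omega> in ?M. ?I \<omega> \<in> space ?A"
    using measurable_space[OF XM(2)] by (intro AE_I2)
  ultimately show ?thesis
    by eventually_elim (simp add: Q control_def)
qed

end

theory Submission
  imports Defs
begin

text \<open>
  Jointly the members have perfect recall: the information at time \<open>t + 1\<close> is the information at
  time \<open>t\<close> together with \<open>U\<^sub>t\<close> and \<open>Y\<^sub>t\<^sub>+\<^sub>1\<close>, and it can be decoded into these.  Independence of the
  primitive random variables gives the joint law of the information, \<open>X\<^sub>t\<close>, \<open>X\<^sub>t\<^sub>+\<^sub>1\<close> and \<open>Y\<^sub>t\<^sub>+\<^sub>1\<close> in
  terms of the densities.  By Bayes' rule, updating the information state at time \<open>t\<close> yields,
  almost everywhere, the information state at time \<open>t + 1\<close>, and the value functions depend only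
  on the almost-everywhere class of their argument.  The inequality then follows by backward
  induction: the infimum is at most the value at the decision prescribed by \<open>g\<close>, and the
  induction hypothesis bounds the continuation value by the conditional expected cost.
\<close>

text \<open>The obstacle is measurability. \<open>V\<close> is an infimum over possibly uncountably
  many decisions, so nothing guarantees that it is measurable along the closed loop, and conditional
  expectations of it are out of reach. The induction therefore carries a measurable, integrable
  function \<open>j\<close> of the information that dominates the value function almost everywhere
  and reproduces the integrals of the remaining cost over all events of the information. Only
  \<open>j\<close> is ever disintegrated; \<open>V\<close> is handled solely through monotonicity of
  \<open>ext_expectation\<close> and its invariance under changes on null sets. Since the infimum is
  compared with the single decision \<open>g s i\<close>, Bayes' rule is required only along
  \<open>g\<close>, and the joint laws of one closed loop suffice. The division in the update is
  meaningful only where the normalising integral is positive and finite; for almost every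
  information the one-step kernel gives the other observations no mass.\<close>

section \<open>Invariance under changes on null sets\<close>

lemma density_cong_AE:
  assumes "AE x in M. f x = g x"
  shows "density M f = density M g"
proof -
  have "(\<integral>\<^sup>+x. f x * indicator A x \<partial>M) = (\<integral>\<^sup>+x. g x * indicator A x \<partial>M)" for A
    by (rule nn_integral_cong_AE) (use assms in auto)
  then show ?thesis by (simp add: density_def)
qed

text \<open>\<open>\<pi>\<close> enters the update only under an integral over \<open>x\<close>, so
  the two results are equal at every \<open>x'\<close>, not merely almost everywhere.
  \<open>value_function_cong\<close> depends on this strength.\<close>

lemma update_cong_AE:
  assumes "AE x in state_space S t. \<pi> x = \<pi>' x"
  shows "update S t \<pi> y u = update S t \<pi>' y u"
proof
  have "(\<integral>\<^sup>+x. trans_dens S t x u x' * \<pi> x \<partial>state_space S t) =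
      (\<integral>\<^sup>+x. trans_dens S t x u x' * \<pi>' x \<partial>state_space S t)" for x'
    by (rule nn_integral_cong_AE) (use assms in auto)
  then show "update S t \<pi> y u x' = update S t \<pi>' y u x'" for x' by (simp add: update_def)
qed

lemma step_law_cong_AE:
  assumes "AE x in state_space S t. \<pi> x = \<pi>' x"
  shows "step_law S t \<pi> u = step_law S t \<pi>' u"
  by (simp add: step_law_def density_cong_AE[OF assms])

lemma sigma_finite_measurements:
  assumes "delayed_sharing_team S"
  shows "sigma_finite_measure (measurements S)"
proof -
  \<comment> \<open>The locale for products asks for sigma-finiteness at every index. Outside the
    members the factor is padded by a one-point space, which a product over
    \<open>{1..members S}\<close> never sees.\<close>
  define O' where "O' k = (if k \<in> {1..members S} then obs_space S k else count_space {undefined})" for k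
  have "sigma_finite_measure (O' k)" for k
    using assms by (auto simp: O'_def delayed_sharing_team_def sigma_finite_measure_count_space_finite)
  then interpret O': product_sigma_finite O' by (simp add: product_sigma_finite_def)
  have "measurements S = PiM {1..members S} O'"
    unfolding measurements_def by (rule PiM_cong) (auto simp: O'_def)
  then show ?thesis using O'.sigma_finite[of "{1..members S}"] by simp
qed

section \<open>Independent sources\<close>

definition source_algebra :: "('a, 'x, 'u, 'y, 'w, 'z) team \<Rightarrow> source set \<Rightarrow> 'a measure" where
  "source_algebra S J = sigma (space (sample S)) (\<Union>(source_events S ` J))"

lemma source_events_subset:
  assumes "delayed_sharing_team S" "J \<subseteq> sources S"
  shows "\<Union>(source_events S ` J) \<subseteq> sets (sample S)"
proof -
  have "prob_space (sample S)" using assms(1) by (simp add: delayed_sharing_team_def)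
  then interpret prob_space "sample S" .
  have "indep_sets (source_events S) (sources S)"
    using assms(1) by (simp add: delayed_sharing_team_def)
  then show ?thesis using assms(2) unfolding indep_sets_def by blast
qed

lemma space_source_algebra [simp]:
  assumes "delayed_sharing_team S" "J \<subseteq> sources S"
  shows "space (source_algebra S J) = space (sample S)"
  using source_events_subset[OF assms] sets.space_closed[of "sample S"]
  unfolding source_algebra_def by (intro space_measure_of) blast

lemma sets_source_algebra:
  assumes "delayed_sharing_team S" "J \<subseteq> sources S"
  shows "sets (source_algebra S J) = sigma_sets (space (sample S)) (\<Union>(source_events S ` J))"
  using source_events_subset[OF assms] sets.space_closed[of "sample S"]
  unfolding source_algebra_def by (intro sets_measure_of) blast

lemma sets_source_algebra_subset:
  assumes "delayed_sharing_team S" "J \<subseteq> sources S"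
  shows "sets (source_algebra S J) \<subseteq> sets (sample S)"
  unfolding sets_source_algebra[OF assms]
  by (rule sets.sigma_sets_subset) (rule source_events_subset[OF assms])

lemma measurable_source_algebra_sample:
  assumes "delayed_sharing_team S" "J \<subseteq> sources S" "f \<in> source_algebra S J \<rightarrow>\<^sub>M K"
  shows "f \<in> sample S \<rightarrow>\<^sub>M K"
  using assms(3) sets_source_algebra_subset[OF assms(1,2)] space_source_algebra[OF assms(1,2)]
  by (auto simp: measurable_def)

lemma measurable_vimage_source:
  assumes team: "delayed_sharing_team S" and J: "J \<subseteq> sources S" "j \<in> J"
    and X: "X \<in> sample S \<rightarrow>\<^sub>M K"
    and j: "source_events S j = sets (vimage_algebra (space (sample S)) X K)"
  shows "X \<in> source_algebra S J \<rightarrow>\<^sub>M K"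
proof -
  have "source_events S j \<subseteq> sets (source_algebra S J)"
    unfolding sets_source_algebra[OF team J(1)] using J(2) by (auto intro: sigma_sets.Basic)
  then show ?thesis
    using X space_source_algebra[OF team J(1)] unfolding j
    by (subst measurable_iff_sets) (auto simp: measurable_def)
qed

lemma primitive_measurable:
  assumes team: "delayed_sharing_team S" and J: "J \<subseteq> sources S"
  shows "Initial \<in> J \<Longrightarrow> init S \<in> source_algebra S J \<rightarrow>\<^sub>M state_space S 0"
    and "Plant t \<in> J \<Longrightarrow> noise S t \<in> source_algebra S J \<rightarrow>\<^sub>M noise_space S t"
    and "Sensor t k \<in> J \<Longrightarrow> sensor S t k \<in> source_algebra S J \<rightarrow>\<^sub>M sensor_space S t k"
proof -
  assume j: "Initial \<in> J"
  show "init S \<in> source_algebra S J \<rightarrow>\<^sub>M state_space S 0"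
    by (rule measurable_vimage_source[OF team J j])
      (use team in \<open>auto simp: delayed_sharing_team_def\<close>)
next
  assume j: "Plant t \<in> J"
  then have "t < horizon S" using J by (auto simp: sources_def)
  then show "noise S t \<in> source_algebra S J \<rightarrow>\<^sub>M noise_space S t"
    by (intro measurable_vimage_source[OF team J j])
      (use team in \<open>auto simp: delayed_sharing_team_def\<close>)
next
  assume j: "Sensor t k \<in> J"
  then have "t \<le> horizon S" "k \<in> {1..members S}" using J by (auto simp: sources_def)
  then show "sensor S t k \<in> source_algebra S J \<rightarrow>\<^sub>M sensor_space S t k"
    by (intro measurable_vimage_source[OF team J j])
      (use team in \<open>auto simp: delayed_sharing_team_def\<close>)
qed

lemma source_algebra_indep:
  assumes team: "delayed_sharing_team S"
    and P: "P \<subseteq> sources S" and F: "F \<subseteq> sources S" and disj: "P \<inter> F = {}"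
    and a: "a \<in> sets (source_algebra S P)" and b: "b \<in> sets (source_algebra S F)"
  shows "emeasure (sample S) (a \<inter> b) = emeasure (sample S) a * emeasure (sample S) b"
proof -
  have "prob_space (sample S)" using team by (simp add: delayed_sharing_team_def)
  then interpret prob_space "sample S" .
  have ind: "indep_sets (source_events S) (sources S)"
    using team by (simp add: delayed_sharing_team_def)
  have int: "Int_stable (source_events S j)" for j by (cases j) (auto intro: sets.Int_stable)
  have "indep_sets (\<lambda>j. sigma_sets (space (sample S)) (\<Union>i\<in>case_bool P F j. source_events S i)) UNIV"
  proof (rule indep_sets_collect_sigma)
    have "(\<Union>j\<in>UNIV. case_bool P F j) = P \<union> F" by (auto simp: UNIV_bool)
    then show "indep_sets (source_events S) (\<Union>j\<in>UNIV. case_bool P F j)"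
      using indep_sets_mono_index[OF _ ind, of "P \<union> F"] P F by simp
    show "disjoint_family_on (case_bool P F) UNIV"
      using disj by (auto simp: disjoint_family_on_def split: bool.split)
  qed (use int in auto)
  then have "indep_set (sets (source_algebra S P)) (sets (source_algebra S F))"
    unfolding indep_set_def sets_source_algebra[OF team P] sets_source_algebra[OF team F]
    by (rule indep_sets_cong[THEN iffD1, rotated -1]) (auto split: bool.split)
  from indep_setD[OF this a b] show ?thesis
    by (simp add: emeasure_eq_measure ennreal_mult'')
qed

text \<open>Freezing: \<open>\<xi>\<close> is built from the sources in \<open>P\<close> and the
  remaining randomness of \<open>\<eta>\<close> from those in \<open>F\<close>, so the average over
  the latter may be taken with \<open>a = \<xi> \<omega>\<close> held fixed. The model supplies
  densities only for such fixed arguments; this turns them into conditional densities along the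
  closed loop.\<close>

lemma nn_integral_indep_distributed:
  assumes team: "delayed_sharing_team S"
    and P: "P \<subseteq> sources S" and F: "F \<subseteq> sources S" and disj: "P \<inter> F = {}"
    and \<xi>: "\<xi> \<in> source_algebra S P \<rightarrow>\<^sub>M A"
    and \<eta>: "(\<lambda>(a, \<omega>). \<eta> a \<omega>) \<in> A \<Otimes>\<^sub>M source_algebra S F \<rightarrow>\<^sub>M B"
    and d: "\<And>a. a \<in> space A \<Longrightarrow> distributed (sample S) B (\<eta> a) (d a)"
    and \<psi>: "\<psi> \<in> borel_measurable (A \<Otimes>\<^sub>M B)"
  shows "(\<integral>\<^sup>+\<omega>. \<psi> (\<xi> \<omega>, \<eta> (\<xi> \<omega>) \<omega>) \<partial>sample S) =
     (\<integral>\<^sup>+\<omega>. (\<integral>\<^sup>+b. d (\<xi> \<omega>) b * \<psi> (\<xi> \<omega>, b) \<partial>B) \<partial>sample S)"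
proof -
  have M: "prob_space (sample S)" using team by (simp add: delayed_sharing_team_def)
  have "(\<lambda>(a, \<omega>). \<psi> (a, \<eta> a \<omega>)) \<in> borel_measurable (A \<Otimes>\<^sub>M source_algebra S F)"
    using measurable_compose[OF measurable_Pair[OF measurable_fst \<eta>] \<psi>] by (simp add: split_beta)
  then have "(\<integral>\<^sup>+\<omega>. (\<lambda>(a, \<omega>). \<psi> (a, \<eta> a \<omega>)) (\<xi> \<omega>, \<omega>) \<partial>sample S) =
      (\<integral>\<^sup>+\<omega>. (\<integral>\<^sup>+\<omega>'. (\<lambda>(a, \<omega>). \<psi> (a, \<eta> a \<omega>)) (\<xi> \<omega>, \<omega>') \<partial>sample S) \<partial>sample S)"
    by (intro nn_integral_indep[OF M, where Np="source_algebra S P" and Nf="source_algebra S F"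
          and A=A] space_source_algebra sets_source_algebra_subset
        source_algebra_indep team P F disj \<xi>) (use P F disj in auto)
  then have "(\<integral>\<^sup>+\<omega>. \<psi> (\<xi> \<omega>, \<eta> (\<xi> \<omega>) \<omega>) \<partial>sample S) =
      (\<integral>\<^sup>+\<omega>. (\<integral>\<^sup>+\<omega>'. \<psi> (\<xi> \<omega>, \<eta> (\<xi> \<omega>) \<omega>') \<partial>sample S) \<partial>sample S)"
    by simp
  also have "\<dots> = (\<integral>\<^sup>+\<omega>. (\<integral>\<^sup>+b. d (\<xi> \<omega>) b * \<psi> (\<xi> \<omega>, b) \<partial>B) \<partial>sample S)"
  proof (rule nn_integral_cong)
    fix \<omega> assume "\<omega> \<in> space (sample S)"
    then have a: "\<xi> \<omega> \<in> space A"
      using measurable_space[OF \<xi>] space_source_algebra[OF team P] by simp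
    have "(\<lambda>b. \<psi> (\<xi> \<omega>, b)) \<in> borel_measurable B"
      by (rule measurable_compose[OF measurable_Pair1'[OF a] \<psi>])
    from distributed_nn_integral[OF d[OF a] this]
    show "(\<integral>\<^sup>+\<omega>'. \<psi> (\<xi> \<omega>, \<eta> (\<xi> \<omega>) \<omega>') \<partial>sample S) = (\<integral>\<^sup>+b. d (\<xi> \<omega>) b * \<psi> (\<xi> \<omega>, b) \<partial>B)" by simp
  qed
  finally show ?thesis .
qed

section \<open>Perfect recall\<close>

text \<open>Each observation up to time \<open>t\<close> is stored exactly once, in the shared part
  if \<open>s + delay S \<le> t\<close> and otherwise member by member in the private parts. This
  decoder, like \<open>info_ctl\<close> for the decisions, looks in the place that holds it.\<close>

definition info_obs :: "('a, 'x, 'u, 'y, 'w, 'z) team \<Rightarrow> nat \<Rightarrow> ('y, 'u) info \<Rightarrow> nat \<Rightarrow> nat \<Rightarrow> 'y" where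
  "info_obs S t i s =
     (\<lambda>k\<in>{1..members S}. if s \<in> shared_times S t then fst (snd i) s k else fst (fst i k) s)"

definition info_ctl :: "('a, 'x, 'u, 'y, 'w, 'z) team \<Rightarrow> nat \<Rightarrow> ('y, 'u) info \<Rightarrow> nat \<Rightarrow> nat \<Rightarrow> 'u" where
  "info_ctl S t i s =
     (\<lambda>k\<in>{1..members S}. if s \<in> shared_times S t then snd (snd i) s k else snd (fst i k) s)"

lemma info_obs_all_info:
  assumes "s \<le> t" "y s \<in> extensional {1..members S}"
  shows "info_obs S t (all_info S t y u) s = y s"
  by (rule extensionalityI[of _ "{1..members S}"])
    (use assms in \<open>auto simp: info_obs_def all_info_def private_info_def shared_info_def
      shared_times_def private_obs_times_def\<close>)

lemma info_ctl_all_info: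
  assumes "s < t" "u s \<in> extensional {1..members S}"
  shows "info_ctl S t (all_info S t y u) s = u s"
  by (rule extensionalityI[of _ "{1..members S}"])
    (use assms in \<open>auto simp: info_ctl_def all_info_def private_info_def shared_info_def
      shared_times_def private_control_times_def\<close>)

text \<open>A delay of at least one keeps \<open>U_t\<close> out of the information: a shared time
  satisfies \<open>s + delay S \<le> t\<close>, hence \<open>s < t\<close>. Entries written at
  \<open>t\<close> for decisions and at \<open>t + 1\<close> for observations are therefore
  invisible at time \<open>t\<close>.\<close>

lemma all_info_cong:
  assumes "1 \<le> delay S" "\<And>s. s \<le> t \<Longrightarrow> y s = y' s" "\<And>s. s < t \<Longrightarrow> u s = u' s"
  shows "all_info S t y u = all_info S t y' u'"
  using assms
  by (auto simp: all_info_def private_info_def shared_info_def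
      shared_times_def private_control_times_def private_obs_times_def intro!: restrict_ext)

text \<open>Points of \<open>info_space\<close> are extensional in every component, so re-encoding
  the decoded histories gives back the same point and not only the same values on the index
  sets.\<close>

lemma all_info_surj:
  assumes i: "i \<in> space (info_space S t)"
  shows "all_info S t (info_obs S t i) (info_ctl S t i) = i"
proof -
  obtain p sy su where i': "i = (p, sy, su)" by (cases i) auto
  have p: "p \<in> extensional {1..members S}"
      "\<And>k. k \<in> {1..members S} \<Longrightarrow> fst (p k) \<in> extensional (private_obs_times S t)"
      "\<And>k. k \<in> {1..members S} \<Longrightarrow> snd (p k) \<in> extensional (private_control_times S t)"
    and s: "sy \<in> extensional (shared_times S t)" "su \<in> extensional (shared_times S t)"
      "\<And>s. s \<in> shared_times S t \<Longrightarrow> sy s \<in> extensional {1..members S}"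
      "\<And>s. s \<in> shared_times S t \<Longrightarrow> su s \<in> extensional {1..members S}"
    using i unfolding i' info_space_def shared_space_def private_space_def measurements_def controls_def
    by (simp_all add: space_pair_measure space_PiM PiE_iff mem_Times_iff)
  have sy: "info_obs S t i s = sy s" "info_ctl S t i s = su s" if "s \<in> shared_times S t" for s
    by (rule extensionalityI[of _ "{1..members S}"];
        use that s in \<open>auto simp: info_obs_def info_ctl_def i'\<close>)+
  have "restrict (info_obs S t i) (shared_times S t) = sy"
    "restrict (info_ctl S t i) (shared_times S t) = su"
    by (rule extensionalityI[of _ "shared_times S t"]; use s sy in auto)+
  moreover have "private_info S t k (info_obs S t i) (info_ctl S t i) = p k" if k: "k \<in> {1..members S}" for k
  proof (rule prod_eqI)
    show "fst (private_info S t k (info_obs S t i) (info_ctl S t i)) = fst (p k)"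
      by (rule extensionalityI[of _ "private_obs_times S t"])
        (use p k in \<open>auto simp: private_info_def info_obs_def i' shared_times_def private_obs_times_def\<close>)
    show "snd (private_info S t k (info_obs S t i) (info_ctl S t i)) = snd (p k)"
      by (rule extensionalityI[of _ "private_control_times S t"])
        (use p k in \<open>auto simp: private_info_def info_ctl_def i' shared_times_def private_control_times_def\<close>)
  qed
  then have "(\<lambda>k\<in>{1..members S}. private_info S t k (info_obs S t i) (info_ctl S t i)) = p"
    by (intro extensionalityI[of _ "{1..members S}"]) (use p in auto)
  ultimately show ?thesis by (simp add: all_info_def shared_info_def i')
qed

lemma measurable_info_obs:
  assumes "s \<le> t"
  shows "(\<lambda>i. info_obs S t i s) \<in> info_space S t \<rightarrow>\<^sub>M measurements S"
  unfolding info_obs_def measurements_def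
proof (rule measurable_restrict)
  fix k assume k: "k \<in> {1..members S}"
  show "(\<lambda>i. if s \<in> shared_times S t then fst (snd i) s k else fst (fst i k) s)
      \<in> info_space S t \<rightarrow>\<^sub>M obs_space S k"
  proof (cases "s \<in> shared_times S t")
    case True
    have "(\<lambda>i. fst (snd i)) \<in> info_space S t \<rightarrow>\<^sub>M PiM (shared_times S t) (\<lambda>_. measurements S)"
      unfolding info_space_def shared_space_def by measurable
    from measurable_compose[OF measurable_compose[OF this measurable_component_singleton[OF True],
        unfolded measurements_def] measurable_component_singleton[OF k]]
    show ?thesis using True by simp
  next
    case False
    then have s: "s \<in> private_obs_times S t"
      using assms by (auto simp: shared_times_def private_obs_times_def)
    have "(\<lambda>i. fst i k) \<in> info_space S t \<rightarrow>\<^sub>M private_space S t k"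
      unfolding info_space_def
      by (rule measurable_compose[OF measurable_fst measurable_component_singleton[OF k]])
    then have "(\<lambda>i. fst (fst i k)) \<in> info_space S t \<rightarrow>\<^sub>M PiM (private_obs_times S t) (\<lambda>_. obs_space S k)"
      unfolding private_space_def by (rule measurable_compose[OF _ measurable_fst])
    from measurable_compose[OF this measurable_component_singleton[OF s]]
    show ?thesis using False by simp
  qed
qed

lemma measurable_info_ctl:
  assumes "s < t"
  shows "(\<lambda>i. info_ctl S t i s) \<in> info_space S t \<rightarrow>\<^sub>M controls S s"
  unfolding info_ctl_def controls_def
proof (rule measurable_restrict)
  fix k assume k: "k \<in> {1..members S}"
  show "(\<lambda>i. if s \<in> shared_times S t then snd (snd i) s k else snd (fst i k) s)
      \<in> info_space S t \<rightarrow>\<^sub>M control_space S s k"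
  proof (cases "s \<in> shared_times S t")
    case True
    have "(\<lambda>i. snd (snd i)) \<in> info_space S t \<rightarrow>\<^sub>M PiM (shared_times S t) (controls S)"
      unfolding info_space_def shared_space_def by measurable
    from measurable_compose[OF measurable_compose[OF this measurable_component_singleton[OF True],
        unfolded controls_def] measurable_component_singleton[OF k]]
    show ?thesis using True by simp
  next
    case False
    then have s: "s \<in> private_control_times S t"
      using assms by (auto simp: shared_times_def private_control_times_def)
    have "(\<lambda>i. fst i k) \<in> info_space S t \<rightarrow>\<^sub>M private_space S t k"
      unfolding info_space_def
      by (rule measurable_compose[OF measurable_fst measurable_component_singleton[OF k]])
    then have "(\<lambda>i. snd (fst i k)) \<in> info_space S t \<rightarrow>\<^sub>M
        PiM (private_control_times S t) (\<lambda>s. control_space S s k)"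
      unfolding private_space_def by (rule measurable_compose[OF _ measurable_snd])
    from measurable_compose[OF this measurable_component_singleton[OF s]]
    show ?thesis using False by simp
  qed
qed

text \<open>Passing to \<open>t + 1\<close> moves the entries whose delay has just expired from the
  private parts to the shared part. Decoding, appending and encoding again avoids describing that
  move.\<close>

definition next_info :: "('a, 'x, 'u, 'y, 'w, 'z) team \<Rightarrow> nat \<Rightarrow> ('y, 'u) info \<Rightarrow> (nat \<Rightarrow> 'u) \<Rightarrow>
    (nat \<Rightarrow> 'y) \<Rightarrow> ('y, 'u) info" where
  "next_info S t i u y =
     all_info S (Suc t) ((info_obs S t i)(Suc t := y)) ((info_ctl S t i)(t := u))"

text \<open>\<open>U_t\<close> is not returned: along a strategy it is a function of the information
  at time \<open>t\<close>.\<close>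

definition prev_info :: "('a, 'x, 'u, 'y, 'w, 'z) team \<Rightarrow> nat \<Rightarrow> ('y, 'u) info \<Rightarrow>
    ('y, 'u) info \<times> (nat \<Rightarrow> 'y)" where
  "prev_info S t i =
     (all_info S t (info_obs S (Suc t) i) (info_ctl S (Suc t) i), info_obs S (Suc t) i (Suc t))"

lemma measurable_next_info:
  assumes d: "1 \<le> delay S" and i: "i \<in> N \<rightarrow>\<^sub>M info_space S t"
    and u: "u \<in> N \<rightarrow>\<^sub>M controls S t" and y: "y \<in> N \<rightarrow>\<^sub>M measurements S"
  shows "(\<lambda>w. next_info S t (i w) (u w) (y w)) \<in> N \<rightarrow>\<^sub>M info_space S (Suc t)"
  unfolding next_info_def fun_upd_def
proof (rule measurable_all_info[OF d])
  show "(\<lambda>w. if s = Suc t then y w else info_obs S t (i w) s) \<in> N \<rightarrow>\<^sub>M measurements S"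
    if "s \<le> Suc t" for s
    using that y measurable_compose[OF i measurable_info_obs, of s] by (cases "s = Suc t") auto
  show "(\<lambda>w. if s = t then u w else info_ctl S t (i w) s) \<in> N \<rightarrow>\<^sub>M controls S s"
    if "s < Suc t" for s
    using that u measurable_compose[OF i measurable_info_ctl, of s] by (cases "s = t") auto
qed

lemma measurable_prev_info:
  assumes "1 \<le> delay S"
  shows "prev_info S t \<in> info_space S (Suc t) \<rightarrow>\<^sub>M info_space S t \<Otimes>\<^sub>M measurements S"
  unfolding prev_info_def[abs_def]
  by (intro measurable_Pair measurable_all_info assms measurable_info_obs measurable_info_ctl) auto

text \<open>This left inverse makes perfect recall usable: every event about the information at
  \<open>t\<close> and \<open>Y_{t+1}\<close> becomes an event about the information at
  \<open>t + 1\<close>. Both Bayes' rule and the tower property below rest on it.\<close>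

lemma prev_next_info:
  assumes d: "1 \<le> delay S" and i: "i \<in> space (info_space S t)"
    and u: "u \<in> space (controls S t)" and y: "y \<in> space (measurements S)"
  shows "prev_info S t (next_info S t i u y) = (i, y)"
proof -
  have e: "u \<in> extensional {1..members S}" "y \<in> extensional {1..members S}"
    using u y by (auto simp: controls_def measurements_def space_PiM PiE_iff)
  have o: "info_obs S (Suc t) (next_info S t i u y) s = ((info_obs S t i)(Suc t := y)) s"
    if "s \<le> Suc t" for s
    unfolding next_info_def using that e
    by (intro info_obs_all_info) (auto simp: info_obs_def)
  have c: "info_ctl S (Suc t) (next_info S t i u y) s = ((info_ctl S t i)(t := u)) s"
    if "s < Suc t" for s
    unfolding next_info_def using that e
    by (intro info_ctl_all_info) (auto simp: info_ctl_def)
  have "all_info S t (info_obs S (Suc t) (next_info S t i u y)) (info_ctl S (Suc t) (next_info S t i u y)) =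
      all_info S t (info_obs S t i) (info_ctl S t i)"
    by (rule all_info_cong[OF d]) (simp_all add: o c)
  also have "\<dots> = i" by (rule all_info_surj[OF i])
  finally show ?thesis by (simp add: prev_info_def o)
qed

text \<open>Measurements are restricted to the members by construction, but decisions are
  extensional only because a strategy takes values in \<open>controls\<close>; hence the hypothesis
  on the past decisions, which decoding must reproduce exactly.\<close>

lemma info_Suc:
  assumes d: "1 \<le> delay S"
    and u: "\<And>s. s < t \<Longrightarrow> control S g s \<omega> \<in> extensional {1..members S}"
  shows "info S g (Suc t) \<omega> =
     next_info S t (info S g t \<omega>) (control S g t \<omega>) (measurement S g (Suc t) \<omega>)"
proof -
  have y: "measurement S g s \<omega> \<in> extensional {1..members S}" for s
    by (simp add: measurement_def obs_def)
  show ?thesis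
    unfolding next_info_def info_eq[OF d]
    by (intro all_info_cong[OF d])
      (auto simp: le_Suc_eq less_Suc_eq intro!: info_obs_all_info[symmetric] info_ctl_all_info[symmetric] u y
       simp del: One_nat_def)
qed

section \<open>Joint laws\<close>

locale closed_loop =
  fixes S :: "('a, 'x, 'u, 'y, 'w, 'z) team"
    and \<rho> :: "nat \<Rightarrow> ('y, 'u) info \<Rightarrow> 'x \<Rightarrow> ennreal"
    and g :: "('y, 'u) strategy"
  assumes team: "delayed_sharing_team S"
    and info_state: "information_state S \<rho>"
    and strategy: "g \<in> strategies S"
begin

sublocale sample: prob_space "sample S"
  using team by (simp add: delayed_sharing_team_def)

sublocale measurements: sigma_finite_measure "measurements S"
  by (rule sigma_finite_measurements[OF team])

lemma sigma_finite_state: "t \<le> horizon S \<Longrightarrow> sigma_finite_measure (state_space S t)"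
  using team by (simp add: delayed_sharing_team_def)

lemma delay: "1 \<le> delay S"
  using team by (simp add: delayed_sharing_team_def)

lemma strategy_measurable: "t < horizon S \<Longrightarrow> g t \<in> info_space S t \<rightarrow>\<^sub>M controls S t"
  using strategy by (simp add: strategies_def)

lemma info_state_measurable:
  "t \<le> horizon S \<Longrightarrow> (\<lambda>(i, x). \<rho> t i x) \<in> borel_measurable (info_space S t \<Otimes>\<^sub>M state_space S t)"
  using info_state by (simp add: information_state_def)

lemma trans_dens_measurable:
  "t < horizon S \<Longrightarrow> (\<lambda>(x, u, x'). trans_dens S t x u x')
     \<in> borel_measurable (state_space S t \<Otimes>\<^sub>M controls S t \<Otimes>\<^sub>M state_space S (Suc t))"
  using team by (simp add: delayed_sharing_team_def)

lemma trans_dens_compose: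
  assumes t: "t < horizon S" and x: "x \<in> N \<rightarrow>\<^sub>M state_space S t"
    and u: "u \<in> N \<rightarrow>\<^sub>M controls S t" and x': "x' \<in> N \<rightarrow>\<^sub>M state_space S (Suc t)"
  shows "(\<lambda>w. trans_dens S t (x w) (u w) (x' w)) \<in> borel_measurable N"
  using measurable_compose[OF measurable_Pair[OF x measurable_Pair[OF u x']] trans_dens_measurable[OF t]]
  by simp

lemma obs_dens_measurable:
  "t \<le> horizon S \<Longrightarrow>
     (\<lambda>(x, y). obs_dens S t x y) \<in> borel_measurable (state_space S t \<Otimes>\<^sub>M measurements S)"
  using team by (simp add: delayed_sharing_team_def)

lemma trans_distributed:
  "t < horizon S \<Longrightarrow> x \<in> space (state_space S t) \<Longrightarrow> u \<in> space (controls S t) \<Longrightarrow>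
     distributed (sample S) (state_space S (Suc t))
       (\<lambda>\<omega>. dynamics S t x u (noise S t \<omega>)) (trans_dens S t x u)"
  using team by (simp add: delayed_sharing_team_def)

lemma obs_distributed:
  "t \<le> horizon S \<Longrightarrow> x \<in> space (state_space S t) \<Longrightarrow>
     distributed (sample S) (measurements S) (obs S t x) (obs_dens S t x)"
  using team by (simp add: delayed_sharing_team_def)

text \<open>The ranges differ by one because \<open>X_t\<close> is driven by plant noise up to
  \<open>t - 1\<close>, while \<open>Y_t\<close> already involves the sensors of time
  \<open>t\<close>.\<close>

definition past :: "nat \<Rightarrow> source set" where
  "past t = insert Initial (Plant ` {..<t} \<union> (\<lambda>(s, k). Sensor s k) ` ({..t} \<times> {1..members S}))"

definition next_sensors :: "nat \<Rightarrow> source set" where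
  "next_sensors t = Sensor (Suc t) ` {1..members S}"

lemma past_sources:
  "t \<le> horizon S \<Longrightarrow> past t \<subseteq> sources S"
  "t < horizon S \<Longrightarrow> insert (Plant t) (past t) \<subseteq> sources S"
  "t < horizon S \<Longrightarrow> {Plant t} \<subseteq> sources S"
  "t < horizon S \<Longrightarrow> next_sensors t \<subseteq> sources S"
  "past t \<inter> {Plant t} = {}"
  "insert (Plant t) (past t) \<inter> next_sensors t = {}"
  "{Plant t} \<inter> next_sensors t = {}"
  by (auto simp: past_def sources_def next_sensors_def)

text \<open>\<open>J\<close> may exceed \<open>past t\<close> because the state and the information
  at time \<open>t\<close> are viewed both in the past and in the past enlarged by
  \<open>Plant t\<close>.\<close>

lemma past_measurable:
  assumes t: "t \<le> horizon S" and J: "past t \<subseteq> J" "J \<subseteq> sources S"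
  shows "state S g t \<in> source_algebra S J \<rightarrow>\<^sub>M state_space S t"
    and "info S g t \<in> source_algebra S J \<rightarrow>\<^sub>M info_space S t"
    and "measurement S g t \<in> source_algebra S J \<rightarrow>\<^sub>M measurements S"
proof -
  have "init S \<in> source_algebra S J \<rightarrow>\<^sub>M state_space S 0"
    by (rule primitive_measurable[OF team J(2)]) (use J(1) in \<open>auto simp: past_def\<close>)
  moreover have "noise S s \<in> source_algebra S J \<rightarrow>\<^sub>M noise_space S s" if "s < t" for s
    by (rule primitive_measurable[OF team J(2)]) (use J(1) that in \<open>auto simp: past_def\<close>)
  moreover have "sensor S s k \<in> source_algebra S J \<rightarrow>\<^sub>M sensor_space S s k"
    if "s \<le> t" "k \<in> {1..members S}" for s k
    by (rule primitive_measurable[OF team J(2)]) (use J(1) that in \<open>force simp: past_def\<close>)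
  ultimately show "state S g t \<in> source_algebra S J \<rightarrow>\<^sub>M state_space S t"
    "info S g t \<in> source_algebra S J \<rightarrow>\<^sub>M info_space S t"
    "measurement S g t \<in> source_algebra S J \<rightarrow>\<^sub>M measurements S"
    using closed_loop_measurable[OF team strategy t] by blast+
qed

lemma run_measurable:
  assumes "t \<le> horizon S"
  shows "state S g t \<in> sample S \<rightarrow>\<^sub>M state_space S t"
    and "info S g t \<in> sample S \<rightarrow>\<^sub>M info_space S t"
    and "measurement S g t \<in> sample S \<rightarrow>\<^sub>M measurements S"
  using past_measurable[OF assms order_refl past_sources(1)[OF assms]]
  by (auto intro: measurable_source_algebra_sample[OF team past_sources(1)[OF assms]])

lemma control_measurable:
  "t < horizon S \<Longrightarrow> control S g t \<in> sample S \<rightarrow>\<^sub>M controls S t"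
  unfolding control_def[abs_def]
  by (rule measurable_compose[OF run_measurable(2) strategy_measurable]) auto

lemma obs_next_measurable:
  assumes t: "t < horizon S" and x: "x \<in> N \<rightarrow>\<^sub>M state_space S (Suc t)"
    and e: "e \<in> N \<rightarrow>\<^sub>M source_algebra S (next_sensors t)"
  shows "(\<lambda>w. obs S (Suc t) (x w) (e w)) \<in> N \<rightarrow>\<^sub>M measurements S"
proof (rule measurable_obs[OF team _ x])
  fix k assume "k \<in> {1..members S}"
  then have "sensor S (Suc t) k \<in> source_algebra S (next_sensors t) \<rightarrow>\<^sub>M sensor_space S (Suc t) k"
    by (intro primitive_measurable[OF team past_sources(4)[OF t]]) (simp add: next_sensors_def)
  then show "(\<lambda>w. sensor S (Suc t) k (e w)) \<in> N \<rightarrow>\<^sub>M sensor_space S (Suc t) k"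
    by (rule measurable_compose[OF e])
qed (use t in simp)

lemma sample_measurable_source_algebra:
  "J \<subseteq> sources S \<Longrightarrow> (\<lambda>\<omega>. \<omega>) \<in> sample S \<rightarrow>\<^sub>M source_algebra S J"
  by (rule measurable_source_algebra_sample[OF team _ measurable_ident_sets]) auto

text \<open>The randomness is peeled off from its latest source backwards. The next sensors are
  independent of the past together with \<open>W_t\<close>, and \<open>W_t\<close> is independent of
  the past; what then remains is an integral over the information and \<open>X_t\<close>, where the
  information state takes over.\<close>

lemma joint_law:
  assumes t: "t < horizon S"
    and \<psi>[measurable]: "\<psi> \<in> borel_measurable
      (((info_space S t \<Otimes>\<^sub>M state_space S t) \<Otimes>\<^sub>M state_space S (Suc t)) \<Otimes>\<^sub>M measurements S)"
  shows "(\<integral>\<^sup>+\<omega>. \<psi> (((info S g t \<omega>, state S g t \<omega>), state S g (Suc t) \<omega>), measurement S g (Suc t) \<omega>) \<partial>sample S) =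
    (\<integral>\<^sup>+\<omega>. (\<integral>\<^sup>+x. \<rho> t (info S g t \<omega>) x *
       (\<integral>\<^sup>+x'. trans_dens S t x (g t (info S g t \<omega>)) x' *
          (\<integral>\<^sup>+y. obs_dens S (Suc t) x' y * \<psi> (((info S g t \<omega>, x), x'), y) \<partial>measurements S)
        \<partial>state_space S (Suc t)) \<partial>state_space S t) \<partial>sample S)"
proof -
  let ?P = "past t" and ?Q = "insert (Plant t) (past t)"
  let ?A = "info_space S t" and ?B = "state_space S t" and ?B' = "state_space S (Suc t)"
  let ?Y = "measurements S"
  let ?I = "info S g t" and ?X = "state S g t" and ?X' = "state S g (Suc t)"
  interpret B: sigma_finite_measure ?B using t by (intro sigma_finite_state) simp
  interpret B': sigma_finite_measure ?B' using t by (intro sigma_finite_state) simp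
  note [measurable] = strategy_measurable[OF t] info_state_measurable[OF less_imp_le[OF t]]
    trans_dens_measurable[OF t] obs_dens_measurable[OF Suc_leI[OF t]]
  note src = past_sources(1)[OF less_imp_le[OF t]] past_sources(2)[OF t] past_sources(3)[OF t]
    past_sources(4)[OF t]
  \<comment> \<open>The integrand after the observation has been averaged out, and below it the
    integrand after the next state has been averaged out too.\<close>
  define \<psi>1 where "\<psi>1 = (\<lambda>(p, x'). \<integral>\<^sup>+y. obs_dens S (Suc t) x' y * \<psi> ((p, x'), y) \<partial>?Y)"
  define \<psi>2 where "\<psi>2 = (\<lambda>(i, x). \<integral>\<^sup>+x'. trans_dens S t x (g t i) x' * \<psi>1 ((i, x), x') \<partial>?B')"
  have \<psi>1[measurable]: "\<psi>1 \<in> borel_measurable ((?A \<Otimes>\<^sub>M ?B) \<Otimes>\<^sub>M ?B')"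
    unfolding \<psi>1_def by measurable
  have \<psi>2[measurable]: "\<psi>2 \<in> borel_measurable (?A \<Otimes>\<^sub>M ?B)"
  proof -
    have "(\<lambda>q. trans_dens S t (snd (fst q)) (g t (fst (fst q))) (snd q) * \<psi>1 q)
        \<in> borel_measurable ((?A \<Otimes>\<^sub>M ?B) \<Otimes>\<^sub>M ?B')"
      by (intro borel_measurable_times_ennreal trans_dens_compose[OF t] \<psi>1) measurable
    from B'.borel_measurable_nn_integral_fst[OF this] show ?thesis
      unfolding \<psi>2_def split_beta by simp
  qed
  have PIX: "(\<lambda>\<omega>. (?I \<omega>, ?X \<omega>)) \<in> source_algebra S J \<rightarrow>\<^sub>M ?A \<Otimes>\<^sub>M ?B"
    if "past t \<subseteq> J" "J \<subseteq> sources S" for J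
    using past_measurable[OF less_imp_le[OF t] that] by measurable
  have W: "noise S t \<in> source_algebra S J \<rightarrow>\<^sub>M noise_space S t" if "Plant t \<in> J" "J \<subseteq> sources S" for J
    using that by (intro primitive_measurable[OF team])
  have X': "?X' \<in> source_algebra S ?Q \<rightarrow>\<^sub>M ?B'"
  proof -
    have "(\<lambda>\<omega>. dynamics S t (?X \<omega>) (g t (?I \<omega>)) (noise S t \<omega>)) \<in> source_algebra S ?Q \<rightarrow>\<^sub>M ?B'"
      using past_measurable[OF less_imp_le[OF t] subset_insertI src(2)] W[OF _ src(2)]
      by (intro measurable_dynamics[OF team t] measurable_compose[OF _ strategy_measurable[OF t]]) auto
    then show ?thesis by (simp add: state_Suc control_def cong: measurable_cong)
  qed
  have "(\<integral>\<^sup>+\<omega>. \<psi> (((?I \<omega>, ?X \<omega>), ?X' \<omega>), measurement S g (Suc t) \<omega>) \<partial>sample S) =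
      (\<integral>\<^sup>+\<omega>. (\<integral>\<^sup>+y. (\<lambda>(p, x'). obs_dens S (Suc t) x') ((?I \<omega>, ?X \<omega>), ?X' \<omega>) y *
         \<psi> (((?I \<omega>, ?X \<omega>), ?X' \<omega>), y) \<partial>?Y) \<partial>sample S)"
  proof -
    \<comment> \<open>The measurement is displayed as a function of the triple to be frozen and of
      fresh randomness, the form in which the freezing lemma applies.\<close>
    have *: "measurement S g (Suc t) \<omega> =
        (\<lambda>(p, x'). obs S (Suc t) x') ((?I \<omega>, ?X \<omega>), ?X' \<omega>) \<omega>" for \<omega>
      by (simp add: measurement_def)
    show ?thesis
      unfolding *
    proof (rule nn_integral_indep_distributed[OF team src(2,4) past_sources(6)])
      show "(\<lambda>\<omega>. ((?I \<omega>, ?X \<omega>), ?X' \<omega>)) \<in> source_algebra S ?Q \<rightarrow>\<^sub>M (?A \<Otimes>\<^sub>M ?B) \<Otimes>\<^sub>M ?B'"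
        by (intro measurable_Pair1 measurable_Pair PIX[OF subset_insertI src(2)] X')
      show "(\<lambda>(a, \<omega>). (case a of (p, x') \<Rightarrow> obs S (Suc t) x') \<omega>)
          \<in> ((?A \<Otimes>\<^sub>M ?B) \<Otimes>\<^sub>M ?B') \<Otimes>\<^sub>M source_algebra S (next_sensors t) \<rightarrow>\<^sub>M ?Y"
        unfolding split_beta by (intro obs_next_measurable[OF t]) auto
    qed (use t in \<open>auto intro!: obs_distributed simp: space_pair_measure\<close>)
  qed
  also have "\<dots> = (\<integral>\<^sup>+\<omega>. \<psi>1 ((?I \<omega>, ?X \<omega>), ?X' \<omega>) \<partial>sample S)"
    by (simp add: \<psi>1_def)
  also have "\<dots> = (\<integral>\<^sup>+\<omega>. (\<integral>\<^sup>+x'. (\<lambda>(i, x). trans_dens S t x (g t i)) (?I \<omega>, ?X \<omega>) x' *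
      \<psi>1 ((?I \<omega>, ?X \<omega>), x') \<partial>?B') \<partial>sample S)"
  proof -
    have *: "?X' \<omega> = (\<lambda>(i, x) \<omega>. dynamics S t x (g t i) (noise S t \<omega>)) (?I \<omega>, ?X \<omega>) \<omega>" for \<omega>
      by (simp add: state_Suc control_def)
    show ?thesis
      unfolding *
    proof (rule nn_integral_indep_distributed[OF team src(1,3) past_sources(5) PIX[OF order_refl src(1)]])
      show "(\<lambda>(a, \<omega>). (case a of (i, x) \<Rightarrow> \<lambda>\<omega>. dynamics S t x (g t i) (noise S t \<omega>)) \<omega>)
          \<in> (?A \<Otimes>\<^sub>M ?B) \<Otimes>\<^sub>M source_algebra S {Plant t} \<rightarrow>\<^sub>M ?B'"
        unfolding split_beta
        by (intro measurable_dynamics[OF team t] measurable_compose[OF _ W[OF _ src(3)]]) auto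
      show "distributed (sample S) ?B' ((\<lambda>(i, x) \<omega>. dynamics S t x (g t i) (noise S t \<omega>)) p)
          ((\<lambda>(i, x). trans_dens S t x (g t i)) p)" if "p \<in> space (?A \<Otimes>\<^sub>M ?B)" for p
        using that measurable_space[OF strategy_measurable[OF t]]
        by (auto simp: space_pair_measure intro!: trans_distributed t)
    qed measurable
  qed
  also have "\<dots> = (\<integral>\<^sup>+\<omega>. \<psi>2 (?I \<omega>, ?X \<omega>) \<partial>sample S)"
    by (simp add: \<psi>2_def)
  also have "\<dots> = (\<integral>\<^sup>+\<omega>. (\<integral>\<^sup>+x. \<rho> t (?I \<omega>) x * \<psi>2 (?I \<omega>, x) \<partial>?B) \<partial>sample S)"
    by (rule information_state_disintegration[OF team info_state strategy less_imp_le[OF t] \<psi>2])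
  finally show ?thesis by (simp add: \<psi>1_def \<psi>2_def)
qed

text \<open>The right-hand side is the inner iterated integral of \<open>joint_law\<close> with
  \<open>\<pi>\<close> and \<open>u\<close> in place of the information state and its decision.
  Matching the two identifies the kernel as the conditional law.\<close>

lemma nn_integral_step_law:
  assumes t: "t < horizon S" and \<pi>[measurable]: "\<pi> \<in> borel_measurable (state_space S t)"
    and u: "u \<in> space (controls S t)"
    and \<phi>[measurable]: "\<phi> \<in> borel_measurable (state_space S t \<Otimes>\<^sub>M measurements S)"
  shows "(\<integral>\<^sup>+z. \<phi> z \<partial>step_law S t \<pi> u) =
     (\<integral>\<^sup>+x. \<pi> x * (\<integral>\<^sup>+x'. trans_dens S t x u x' *
        (\<integral>\<^sup>+y. obs_dens S (Suc t) x' y * \<phi> (x, y) \<partial>measurements S)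
      \<partial>state_space S (Suc t)) \<partial>state_space S t)"
proof -
  let ?B = "state_space S t" and ?B' = "state_space S (Suc t)" and ?Y = "measurements S"
  let ?D = "density ?B \<pi>"
  interpret B: sigma_finite_measure ?B using t by (intro sigma_finite_state) simp
  interpret B': sigma_finite_measure ?B' using t by (intro sigma_finite_state) simp
  note src = past_sources(3)[OF t] past_sources(4)[OF t]
  note [measurable] = obs_dens_measurable[OF Suc_leI[OF t]]
  have W: "noise S t \<in> source_algebra S {Plant t} \<rightarrow>\<^sub>M noise_space S t"
    by (rule primitive_measurable[OF team src(1)]) simp
  have WM: "noise S t \<in> sample S \<rightarrow>\<^sub>M noise_space S t"
    by (rule measurable_source_algebra_sample[OF team src(1) W])
  have \<zeta>: "(\<lambda>p. obs S (Suc t) (dynamics S t (fst p) u (noise S t (snd p))) (snd p))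
      \<in> ?B \<Otimes>\<^sub>M sample S \<rightarrow>\<^sub>M ?Y"
    using u by (intro obs_next_measurable t measurable_dynamics[OF team t]
        measurable_compose[OF _ WM] measurable_compose[OF _ sample_measurable_source_algebra[OF src(2)]]) auto
  have m: "(\<lambda>(x, \<omega>). (x, obs S (Suc t) (dynamics S t x u (noise S t \<omega>)) \<omega>))
      \<in> ?B \<Otimes>\<^sub>M sample S \<rightarrow>\<^sub>M ?B \<Otimes>\<^sub>M ?Y"
    unfolding split_beta using \<zeta> by measurable
  note m\<phi>[measurable] = measurable_compose[OF m \<phi>]
  have "(\<integral>\<^sup>+z. \<phi> z \<partial>step_law S t \<pi> u) =
      (\<integral>\<^sup>+p. \<phi> (case p of (x, \<omega>) \<Rightarrow> (x, obs S (Suc t) (dynamics S t x u (noise S t \<omega>)) \<omega>)) \<partial>(?D \<Otimes>\<^sub>M sample S))"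
    unfolding step_law_def using m by (subst nn_integral_distr) auto
  also have "\<dots> = (\<integral>\<^sup>+x. (\<integral>\<^sup>+\<omega>. \<phi> (x, obs S (Suc t) (dynamics S t x u (noise S t \<omega>)) \<omega>) \<partial>sample S) \<partial>?D)"
    by (subst sample.nn_integral_fst[symmetric]) auto
  also have "\<dots> = (\<integral>\<^sup>+x. \<pi> x * (\<integral>\<^sup>+\<omega>. \<phi> (x, obs S (Suc t) (dynamics S t x u (noise S t \<omega>)) \<omega>) \<partial>sample S) \<partial>?B)"
    using sample.borel_measurable_nn_integral_fst[OF m\<phi>]
    by (subst nn_integral_density) auto
  also have "\<dots> = (\<integral>\<^sup>+x. \<pi> x * (\<integral>\<^sup>+x'. trans_dens S t x u x' *
        (\<integral>\<^sup>+y. obs_dens S (Suc t) x' y * \<phi> (x, y) \<partial>?Y) \<partial>?B') \<partial>?B)"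
  proof (rule nn_integral_cong)
    fix x assume x: "x \<in> space ?B"
    have \<phi>x[measurable]: "(\<lambda>y. \<phi> (x, y)) \<in> borel_measurable ?Y"
      by (rule measurable_compose[OF measurable_Pair1'[OF x] \<phi>])
    \<comment> \<open>With \<open>x\<close> and \<open>u\<close> fixed, the next state depends on
      the plant noise alone, so the split is between \<open>{Plant t}\<close> and the next
      sensors.\<close>
    let ?\<xi> = "\<lambda>\<omega>. dynamics S t x u (noise S t \<omega>)"
    have "?\<xi> \<in> source_algebra S {Plant t} \<rightarrow>\<^sub>M ?B'"
      using u x W by (intro measurable_dynamics[OF team t]) auto
    then have "(\<integral>\<^sup>+\<omega>. (\<lambda>(x', y). \<phi> (x, y)) (?\<xi> \<omega>, obs S (Suc t) (?\<xi> \<omega>) \<omega>) \<partial>sample S) =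
        (\<integral>\<^sup>+\<omega>. (\<integral>\<^sup>+y. obs_dens S (Suc t) (?\<xi> \<omega>) y * (\<lambda>(x', y). \<phi> (x, y)) (?\<xi> \<omega>, y) \<partial>?Y) \<partial>sample S)"
    proof (rule nn_integral_indep_distributed[OF team src past_sources(7)])
      show "(\<lambda>(x', \<omega>). obs S (Suc t) x' \<omega>) \<in> ?B' \<Otimes>\<^sub>M source_algebra S (next_sensors t) \<rightarrow>\<^sub>M ?Y"
        unfolding split_beta by (intro obs_next_measurable[OF t]) auto
    qed (use t in \<open>auto intro!: obs_distributed\<close>)
    also have "\<dots> = (\<integral>\<^sup>+x'. trans_dens S t x u x' * (\<integral>\<^sup>+y. obs_dens S (Suc t) x' y * \<phi> (x, y) \<partial>?Y) \<partial>?B')"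
      by (subst distributed_nn_integral[OF trans_distributed[OF t x u], symmetric]) simp_all
    finally show "\<pi> x * (\<integral>\<^sup>+\<omega>. \<phi> (x, obs S (Suc t) (?\<xi> \<omega>) \<omega>) \<partial>sample S) = \<pi> x *
        (\<integral>\<^sup>+x'. trans_dens S t x u x' * (\<integral>\<^sup>+y. obs_dens S (Suc t) x' y * \<phi> (x, y) \<partial>?Y) \<partial>?B')"
      by simp
  qed
  finally show ?thesis .
qed

end

section \<open>Disintegration of real integrals\<close>

text \<open>Positive and negative parts are disintegrated separately. Integrability makes both
  kernel integrals finite for almost every \<open>i\<close>, so their difference makes sense there.
  The kernel is left abstract because the lemma serves twice: for the law of the state at the final
  time and for the one-step law.\<close>

lemma disintegrate_integral:
  fixes h :: "'i \<times> 'z \<Rightarrow> real"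
  assumes \<xi>[measurable]: "\<xi> \<in> M \<rightarrow>\<^sub>M A" and \<eta>[measurable]: "\<eta> \<in> M \<rightarrow>\<^sub>M B"
    and \<kappa>: "\<And>i. i \<in> space A \<Longrightarrow> sets (\<kappa> i) = sets B"
    and meas: "\<And>\<psi>. \<psi> \<in> borel_measurable (A \<Otimes>\<^sub>M B) \<Longrightarrow>
        (\<lambda>i. \<integral>\<^sup>+z. \<psi> (i, z) \<partial>\<kappa> i) \<in> borel_measurable A"
    and dis: "\<And>\<psi>. \<psi> \<in> borel_measurable (A \<Otimes>\<^sub>M B) \<Longrightarrow>
        (\<integral>\<^sup>+\<omega>. \<psi> (\<xi> \<omega>, \<eta> \<omega>) \<partial>M) = (\<integral>\<^sup>+i. (\<integral>\<^sup>+z. \<psi> (i, z) \<partial>\<kappa> i) \<partial>distr M A \<xi>)"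
    and h[measurable]: "h \<in> borel_measurable (A \<Otimes>\<^sub>M B)"
    and int: "integrable M (\<lambda>\<omega>. h (\<xi> \<omega>, \<eta> \<omega>))"
  shows "\<exists>j\<in>borel_measurable A. integrable (distr M A \<xi>) j \<and>
     (AE i in distr M A \<xi>. integrable (\<kappa> i) (\<lambda>z. h (i, z)) \<and> (\<integral>z. h (i, z) \<partial>\<kappa> i) = j i) \<and>
     (\<forall>a\<in>sets A. (\<integral>\<omega>. indicator a (\<xi> \<omega>) * h (\<xi> \<omega>, \<eta> \<omega>) \<partial>M) =
        (\<integral>i. indicator a i * j i \<partial>distr M A \<xi>))"
proof -
  let ?L = "distr M A \<xi>"
  define P where "P = (\<lambda>(f :: 'i \<times> 'z \<Rightarrow> real) i. \<integral>\<^sup>+z. ennreal (f (i, z)) \<partial>\<kappa> i)"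
  have PM[measurable]: "P f \<in> borel_measurable A" if "f \<in> borel_measurable (A \<Otimes>\<^sub>M B)" for f
    unfolding P_def by (rule meas) (use that in measurable)
  have part: "(AE i in ?L. P f i < \<top>) \<and> integrable ?L (\<lambda>i. enn2real (P f i)) \<and>
      (\<forall>a\<in>sets A. enn2real (\<integral>\<^sup>+\<omega>. ennreal (indicator a (\<xi> \<omega>) * f (\<xi> \<omega>, \<eta> \<omega>)) \<partial>M) =
         (\<integral>i. indicator a i * enn2real (P f i) \<partial>?L))"
    if f[measurable]: "f \<in> borel_measurable (A \<Otimes>\<^sub>M B)"
      and fin: "(\<integral>\<^sup>+\<omega>. ennreal (f (\<xi> \<omega>, \<eta> \<omega>)) \<partial>M) < \<top>" for f
  proof (intro conjI ballI)
    have Pf: "(\<integral>\<^sup>+i. P f i \<partial>?L) < \<top>"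
      using fin dis[of "\<lambda>z. ennreal (f z)"] by (simp add: P_def)
    then show ae: "AE i in ?L. P f i < \<top>"
      using nn_integral_PInf_AE[of "P f" ?L] f by (auto simp: top.not_eq_extremum)
    have "(\<integral>\<^sup>+i. ennreal (enn2real (P f i)) \<partial>?L) \<le> (\<integral>\<^sup>+i. P f i \<partial>?L)"
      by (rule nn_integral_mono) (simp add: ennreal_enn2real_if)
    then show "integrable ?L (\<lambda>i. enn2real (P f i))"
      using Pf by (intro integrableI_bounded) (auto simp: top.not_eq_extremum)
    fix a assume a[measurable]: "a \<in> sets A"
    have "(\<integral>\<^sup>+\<omega>. ennreal (indicator a (\<xi> \<omega>) * f (\<xi> \<omega>, \<eta> \<omega>)) \<partial>M) =
        (\<integral>\<^sup>+i. (\<integral>\<^sup>+z. ennreal (indicator a i * f (i, z)) \<partial>\<kappa> i) \<partial>?L)"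
      using dis[of "\<lambda>(i, z). ennreal (indicator a i * f (i, z))"] by simp
    also have "\<dots> = (\<integral>\<^sup>+i. ennreal (indicator a i * enn2real (P f i)) \<partial>?L)"
      by (rule nn_integral_cong_AE)
        (use ae in \<open>auto simp: P_def indicator_def ennreal_enn2real_if\<close>)
    finally show "enn2real (\<integral>\<^sup>+\<omega>. ennreal (indicator a (\<xi> \<omega>) * f (\<xi> \<omega>, \<eta> \<omega>)) \<partial>M) =
         (\<integral>i. indicator a i * enn2real (P f i) \<partial>?L)"
      by (subst integral_eq_nn_integral) auto
  qed
  have fin: "(\<integral>\<^sup>+\<omega>. ennreal (h (\<xi> \<omega>, \<eta> \<omega>)) \<partial>M) < \<top>" "(\<integral>\<^sup>+\<omega>. ennreal (- h (\<xi> \<omega>, \<eta> \<omega>)) \<partial>M) < \<top>"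
    using int by (auto simp: real_integrable_def top.not_eq_extremum)
  note pos = part[OF h fin(1)] and neg = part[of "\<lambda>z. - h z", OF _ fin(2)]
  \<comment> \<open>\<open>enn2real\<close> sends an infinite part to 0, so \<open>j\<close> is real
    and measurable everywhere; it can differ from the kernel integral only on a null set.\<close>
  define j where "j = (\<lambda>i. enn2real (P h i) - enn2real (P (\<lambda>z. - h z) i))"
  show ?thesis
  proof (intro bexI[of _ j] conjI ballI)
    show "j \<in> borel_measurable A" unfolding j_def by measurable
    show "integrable ?L j"
      unfolding j_def using pos neg by (intro Bochner_Integration.integrable_diff) auto
    have "AE i in ?L. i \<in> space A" using AE_space[of ?L] by simp
    moreover have "AE i in ?L. P h i < \<top>" "AE i in ?L. P (\<lambda>z. - h z) i < \<top>"
      using pos neg by auto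
    ultimately show "AE i in ?L. integrable (\<kappa> i) (\<lambda>z. h (i, z)) \<and> (\<integral>z. h (i, z) \<partial>\<kappa> i) = j i"
    proof eventually_elim
      case (elim i)
      have "(\<lambda>z. h (i, z)) \<in> borel_measurable B"
        by (rule measurable_compose[OF measurable_Pair1'[OF elim(1)] h])
      then have "integrable (\<kappa> i) (\<lambda>z. h (i, z))"
        using elim(2,3) \<kappa>[OF elim(1)] unfolding P_def
        by (subst real_integrable_def) (auto cong: measurable_cong_sets)
      then show ?case by (simp add: real_lebesgue_integral_def j_def P_def)
    qed
    fix a assume a[measurable]: "a \<in> sets A"
    have ind: "integrable ?L (\<lambda>i. indicator a i * f i)" if "integrable ?L f" for f :: "'i \<Rightarrow> real"
      using integrable_mult_indicator[of a ?L f] that by simp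
    have "integrable M (\<lambda>\<omega>. indicator a (\<xi> \<omega>) * h (\<xi> \<omega>, \<eta> \<omega>))"
      by (rule Bochner_Integration.integrable_bound[OF int]) (auto simp: indicator_def)
    then have "(\<integral>\<omega>. indicator a (\<xi> \<omega>) * h (\<xi> \<omega>, \<eta> \<omega>) \<partial>M) =
        (\<integral>i. indicator a i * enn2real (P h i) \<partial>?L) - (\<integral>i. indicator a i * enn2real (P (\<lambda>z. - h z) i) \<partial>?L)"
      using pos neg a by (simp add: real_lebesgue_integral_def)
    also have "\<dots> = (\<integral>i. indicator a i * enn2real (P h i) - indicator a i * enn2real (P (\<lambda>z. - h z) i) \<partial>?L)"
      using pos neg ind by (intro Bochner_Integration.integral_diff[symmetric]) auto
    finally show "(\<integral>\<omega>. indicator a (\<xi> \<omega>) * h (\<xi> \<omega>, \<eta> \<omega>) \<partial>M) = (\<integral>i. indicator a i * j i \<partial>?L)"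
      by (simp add: j_def right_diff_distrib)
  qed
qed

section \<open>Conditional laws given the information\<close>

context closed_loop
begin

definition info_law :: "nat \<Rightarrow> ('y, 'u) info measure" where
  "info_law t = distr (sample S) (info_space S t) (info S g t)"

lemma sets_info_law [measurable_cong, simp]: "sets (info_law t) = sets (info_space S t)"
  by (simp add: info_law_def)

lemma space_info_law [simp]: "space (info_law t) = space (info_space S t)"
  by (simp add: info_law_def)

lemma prob_space_info_law: "t \<le> horizon S \<Longrightarrow> prob_space (info_law t)"
  unfolding info_law_def by (rule sample.prob_space_distr) (rule run_measurable)

lemma info_state_section:
  assumes "t \<le> horizon S" "i \<in> space (info_space S t)"
  shows "\<rho> t i \<in> borel_measurable (state_space S t)"
  using measurable_compose[OF measurable_Pair1'[OF assms(2)] info_state_measurable[OF assms(1)]] by simp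

lemma info_Suc_control:
  assumes t: "t < horizon S" and \<omega>: "\<omega> \<in> space (sample S)"
  shows "info S g (Suc t) \<omega> =
     next_info S t (info S g t \<omega>) (g t (info S g t \<omega>)) (measurement S g (Suc t) \<omega>)"
proof -
  have "control S g s \<omega> \<in> extensional {1..members S}" if "s < t" for s
    using measurable_space[OF control_measurable \<omega>, of s] t that
    by (auto simp: controls_def space_PiM PiE_iff)
  from info_Suc[OF delay this, of t] show ?thesis by (simp add: control_def)
qed

lemma next_info_measurable:
  assumes t: "t < horizon S"
  shows "(\<lambda>(i, y). next_info S t i (g t i) y) \<in> info_space S t \<Otimes>\<^sub>M measurements S \<rightarrow>\<^sub>M info_space S (Suc t)"
  unfolding split_beta
  by (intro measurable_next_info delay measurable_compose[OF _ strategy_measurable[OF t]]) auto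

text \<open>The final-time kernel in the form that \<open>disintegrate_integral\<close> expects.
  Sections of \<open>\<rho>\<close> are known to be measurable only at points of the information
  space, so the density is unfolded only there.\<close>

lemma state_disintegration:
  assumes t: "t \<le> horizon S" and \<psi>[measurable]: "\<psi> \<in> borel_measurable (info_space S t \<Otimes>\<^sub>M state_space S t)"
  shows "(\<lambda>i. \<integral>\<^sup>+x. \<psi> (i, x) \<partial>density (state_space S t) (\<rho> t i)) \<in> borel_measurable (info_space S t)"
    and "(\<integral>\<^sup>+\<omega>. \<psi> (info S g t \<omega>, state S g t \<omega>) \<partial>sample S) =
      (\<integral>\<^sup>+i. (\<integral>\<^sup>+x. \<psi> (i, x) \<partial>density (state_space S t) (\<rho> t i)) \<partial>info_law t)"
proof -
  interpret B: sigma_finite_measure "state_space S t" by (rule sigma_finite_state[OF t])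
  note [measurable] = info_state_measurable[OF t]
  have eq: "(\<integral>\<^sup>+x. \<psi> (i, x) \<partial>density (state_space S t) (\<rho> t i)) = (\<integral>\<^sup>+x. \<rho> t i x * \<psi> (i, x) \<partial>state_space S t)"
    if "i \<in> space (info_space S t)" for i
    using info_state_section[OF t that] measurable_compose[OF measurable_Pair1'[OF that] \<psi>]
    by (intro nn_integral_density)
  have m: "(\<lambda>i. \<integral>\<^sup>+x. \<rho> t i x * \<psi> (i, x) \<partial>state_space S t) \<in> borel_measurable (info_space S t)"
    by measurable
  then show "(\<lambda>i. \<integral>\<^sup>+x. \<psi> (i, x) \<partial>density (state_space S t) (\<rho> t i)) \<in> borel_measurable (info_space S t)"
    by (subst measurable_cong[OF eq])
  have "(\<integral>\<^sup>+i. (\<integral>\<^sup>+x. \<psi> (i, x) \<partial>density (state_space S t) (\<rho> t i)) \<partial>info_law t) =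
      (\<integral>\<^sup>+i. (\<integral>\<^sup>+x. \<rho> t i x * \<psi> (i, x) \<partial>state_space S t) \<partial>info_law t)"
    by (rule nn_integral_cong) (simp add: eq)
  also have "\<dots> = (\<integral>\<^sup>+\<omega>. (\<integral>\<^sup>+x. \<rho> t (info S g t \<omega>) x * \<psi> (info S g t \<omega>, x) \<partial>state_space S t) \<partial>sample S)"
    unfolding info_law_def by (rule nn_integral_distr[OF run_measurable(2)[OF t]]) (use m in simp)
  finally show "(\<integral>\<^sup>+\<omega>. \<psi> (info S g t \<omega>, state S g t \<omega>) \<partial>sample S) =
      (\<integral>\<^sup>+i. (\<integral>\<^sup>+x. \<psi> (i, x) \<partial>density (state_space S t) (\<rho> t i)) \<partial>info_law t)"
    using information_state_disintegration[OF team info_state strategy t \<psi>] by simp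
qed

text \<open>The joint density of \<open>X\<^sub>t\<^sub>+\<^sub>1\<close> and \<open>Y\<^sub>t\<^sub>+\<^sub>1\<close> given the information, i.e. the numerator of the
  update at the information state.\<close>

definition joint_dens :: "nat \<Rightarrow> ('y, 'u) info \<Rightarrow> (nat \<Rightarrow> 'y) \<Rightarrow> 'x \<Rightarrow> ennreal" where
  "joint_dens t i y x' = obs_dens S (Suc t) x' y *
     (\<integral>\<^sup>+x. trans_dens S t x (g t i) x' * \<rho> t i x \<partial>state_space S t)"

lemma joint_dens_measurable:
  assumes t: "t < horizon S"
  shows "(\<lambda>((i, y), x'). joint_dens t i y x')
     \<in> borel_measurable ((info_space S t \<Otimes>\<^sub>M measurements S) \<Otimes>\<^sub>M state_space S (Suc t))"
proof -
  let ?A = "info_space S t" and ?B = "state_space S t" and ?B' = "state_space S (Suc t)"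
  interpret B: sigma_finite_measure ?B using t by (intro sigma_finite_state) simp
  note [measurable] = obs_dens_measurable[OF Suc_leI[OF t]] info_state_measurable[OF less_imp_le[OF t]]
    strategy_measurable[OF t]
  have "(\<lambda>((i, x'), x). trans_dens S t x (g t i) x' * \<rho> t i x)
      \<in> borel_measurable ((?A \<Otimes>\<^sub>M ?B') \<Otimes>\<^sub>M ?B)"
    unfolding split_beta by (intro borel_measurable_times_ennreal trans_dens_compose[OF t]) measurable
  from B.borel_measurable_nn_integral_fst[OF this]
  have G: "(\<lambda>(i, x'). \<integral>\<^sup>+x. trans_dens S t x (g t i) x' * \<rho> t i x \<partial>?B)
      \<in> borel_measurable (?A \<Otimes>\<^sub>M ?B')"
    by (simp add: split_beta)
  have o: "(\<lambda>q. obs_dens S (Suc t) (snd q) (snd (fst q)))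
      \<in> borel_measurable ((?A \<Otimes>\<^sub>M measurements S) \<Otimes>\<^sub>M ?B')"
    by measurable
  have p: "(\<lambda>q. (fst (fst q), snd q)) \<in> (?A \<Otimes>\<^sub>M measurements S) \<Otimes>\<^sub>M ?B' \<rightarrow>\<^sub>M ?A \<Otimes>\<^sub>M ?B'"
    by measurable
  show ?thesis
    using borel_measurable_times_ennreal[OF o measurable_compose[OF p G]]
    by (simp add: joint_dens_def case_prod_beta')
qed

text \<open>Two exchanges by Tonelli's theorem bring \<open>y\<close> outermost and \<open>x\<close>
  innermost. The model generates the variables in the order \<open>x\<close>, \<open>x'\<close>,
  \<open>y\<close>, whereas Bayes' rule starts from the observation.\<close>

lemma joint_dens_swap:
  assumes t: "t < horizon S" and i: "i \<in> space (info_space S t)"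
    and f[measurable]: "f \<in> borel_measurable (measurements S \<Otimes>\<^sub>M state_space S (Suc t))"
  shows "(\<integral>\<^sup>+x. \<rho> t i x * (\<integral>\<^sup>+x'. trans_dens S t x (g t i) x' *
        (\<integral>\<^sup>+y. obs_dens S (Suc t) x' y * f (y, x') \<partial>measurements S) \<partial>state_space S (Suc t)) \<partial>state_space S t) =
     (\<integral>\<^sup>+y. (\<integral>\<^sup>+x'. joint_dens t i y x' * f (y, x') \<partial>state_space S (Suc t)) \<partial>measurements S)"
proof -
  let ?B = "state_space S t" and ?B' = "state_space S (Suc t)" and ?Y = "measurements S"
  interpret B: sigma_finite_measure ?B using t by (intro sigma_finite_state) simp
  interpret B': sigma_finite_measure ?B' using t by (intro sigma_finite_state) simp
  interpret BB': pair_sigma_finite ?B ?B' ..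
  interpret YB': pair_sigma_finite ?Y ?B' ..
  note [measurable] = obs_dens_measurable[OF Suc_leI[OF t]] info_state_section[OF less_imp_le[OF t] i]
  have u: "g t i \<in> space (controls S t)" using measurable_space[OF strategy_measurable[OF t] i] .
  have tr[measurable]: "(\<lambda>(x, x'). trans_dens S t x (g t i) x') \<in> borel_measurable (?B \<Otimes>\<^sub>M ?B')"
    unfolding split_beta using u by (intro trans_dens_compose[OF t]) auto
  define F where "F = (\<lambda>x'. \<integral>\<^sup>+y. obs_dens S (Suc t) x' y * f (y, x') \<partial>?Y)"
  have [measurable]: "F \<in> borel_measurable ?B'" unfolding F_def by measurable
  define G where "G = (\<lambda>x'. \<integral>\<^sup>+x. trans_dens S t x (g t i) x' * \<rho> t i x \<partial>?B)"
  have [measurable]: "G \<in> borel_measurable ?B'" unfolding G_def by measurable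
  have "(\<integral>\<^sup>+x. \<rho> t i x * (\<integral>\<^sup>+x'. trans_dens S t x (g t i) x' * F x' \<partial>?B') \<partial>?B) =
      (\<integral>\<^sup>+x. (\<integral>\<^sup>+x'. \<rho> t i x * (trans_dens S t x (g t i) x' * F x') \<partial>?B') \<partial>?B)"
    by (intro nn_integral_cong nn_integral_cmult[symmetric])
      (use u in \<open>auto intro!: borel_measurable_times_ennreal trans_dens_compose[OF t]\<close>)
  also have "\<dots> = (\<integral>\<^sup>+x'. (\<integral>\<^sup>+x. \<rho> t i x * (trans_dens S t x (g t i) x' * F x') \<partial>?B) \<partial>?B')"
    by (rule BB'.Fubini'[symmetric]) measurable
  also have "\<dots> = (\<integral>\<^sup>+x'. G x' * F x' \<partial>?B')"
    unfolding G_def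
    by (intro nn_integral_cong, subst nn_integral_multc[symmetric])
      (use u in \<open>auto intro!: borel_measurable_times_ennreal trans_dens_compose[OF t] nn_integral_cong simp: ac_simps\<close>)
  also have "\<dots> = (\<integral>\<^sup>+x'. (\<integral>\<^sup>+y. G x' * (obs_dens S (Suc t) x' y * f (y, x')) \<partial>?Y) \<partial>?B')"
    unfolding F_def by (intro nn_integral_cong nn_integral_cmult[symmetric]) measurable
  also have "\<dots> = (\<integral>\<^sup>+y. (\<integral>\<^sup>+x'. G x' * (obs_dens S (Suc t) x' y * f (y, x')) \<partial>?B') \<partial>?Y)"
    by (rule YB'.Fubini') measurable
  finally show ?thesis by (simp add: F_def G_def joint_dens_def ac_simps)
qed


text \<open>Both sides reduce to the same iterated integral, by \<open>joint_law\<close> and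
  \<open>nn_integral_step_law\<close>. Unlike in \<open>step_law_cond_exp\<close>, the integrand may
  also depend on the information, as the continuation cost does through the next
  information.\<close>

lemma step_disintegration:
  assumes t: "t < horizon S"
    and \<psi>[measurable]: "\<psi> \<in> borel_measurable
      (info_space S t \<Otimes>\<^sub>M state_space S t \<Otimes>\<^sub>M measurements S)"
  shows "(\<lambda>i. \<integral>\<^sup>+z. \<psi> (i, z) \<partial>step_law S t (\<rho> t i) (g t i)) \<in> borel_measurable (info_space S t)"
    and "(\<integral>\<^sup>+\<omega>. \<psi> (info S g t \<omega>, state S g t \<omega>, measurement S g (Suc t) \<omega>) \<partial>sample S) =
      (\<integral>\<^sup>+i. (\<integral>\<^sup>+z. \<psi> (i, z) \<partial>step_law S t (\<rho> t i) (g t i)) \<partial>info_law t)"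
proof -
  let ?A = "info_space S t" and ?B = "state_space S t" and ?B' = "state_space S (Suc t)"
  let ?Y = "measurements S"
  interpret B: sigma_finite_measure ?B using t by (intro sigma_finite_state) simp
  interpret B': sigma_finite_measure ?B' using t by (intro sigma_finite_state) simp
  note [measurable] = strategy_measurable[OF t] info_state_measurable[OF less_imp_le[OF t]]
    obs_dens_measurable[OF Suc_leI[OF t]]
  define K1 where "K1 = (\<lambda>q. \<integral>\<^sup>+y. obs_dens S (Suc t) (snd q) y *
      \<psi> (fst (fst q), snd (fst q), y) \<partial>?Y)"
  define K2 where "K2 = (\<lambda>p. \<integral>\<^sup>+x'. trans_dens S t (snd p) (g t (fst p)) x' * K1 (p, x') \<partial>?B')"
  define K3 where "K3 = (\<lambda>i. \<integral>\<^sup>+x. \<rho> t i x * K2 (i, x) \<partial>?B)"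
  have [measurable]: "K1 \<in> borel_measurable ((?A \<Otimes>\<^sub>M ?B) \<Otimes>\<^sub>M ?B')"
    unfolding K1_def by measurable
  have "(\<lambda>q. trans_dens S t (snd (fst q)) (g t (fst (fst q))) (snd q) * K1 q)
      \<in> borel_measurable ((?A \<Otimes>\<^sub>M ?B) \<Otimes>\<^sub>M ?B')"
    by (intro borel_measurable_times_ennreal trans_dens_compose[OF t]) measurable
  from B'.borel_measurable_nn_integral_fst[OF this]
  have [measurable]: "K2 \<in> borel_measurable (?A \<Otimes>\<^sub>M ?B)" by (simp add: K2_def)
  have K3[measurable]: "K3 \<in> borel_measurable ?A"
    unfolding K3_def by measurable
  have eq: "(\<integral>\<^sup>+z. \<psi> (i, z) \<partial>step_law S t (\<rho> t i) (g t i)) = K3 i" if i: "i \<in> space ?A" for i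
    using nn_integral_step_law[OF t info_state_section[OF less_imp_le[OF t] i]
        measurable_space[OF strategy_measurable[OF t] i] measurable_compose[OF measurable_Pair1'[OF i] \<psi>]]
    by (simp add: K1_def K2_def K3_def)
  show "(\<lambda>i. \<integral>\<^sup>+z. \<psi> (i, z) \<partial>step_law S t (\<rho> t i) (g t i)) \<in> borel_measurable (info_space S t)"
    using K3 by (subst measurable_cong[OF eq])
  have "(\<lambda>r. \<psi> (fst (fst (fst r)), snd (fst (fst r)), snd r)) \<in> borel_measurable (((?A \<Otimes>\<^sub>M ?B) \<Otimes>\<^sub>M ?B') \<Otimes>\<^sub>M ?Y)"
    by measurable
  from joint_law[OF t this]
  have "(\<integral>\<^sup>+\<omega>. \<psi> (info S g t \<omega>, state S g t \<omega>, measurement S g (Suc t) \<omega>) \<partial>sample S) =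
      (\<integral>\<^sup>+\<omega>. K3 (info S g t \<omega>) \<partial>sample S)"
    by (simp add: K1_def K2_def K3_def)
  also have "\<dots> = (\<integral>\<^sup>+i. K3 i \<partial>info_law t)"
    unfolding info_law_def by (rule nn_integral_distr[symmetric]) (use t run_measurable in auto)
  also have "\<dots> = (\<integral>\<^sup>+i. (\<integral>\<^sup>+z. \<psi> (i, z) \<partial>step_law S t (\<rho> t i) (g t i)) \<partial>info_law t)"
    by (rule nn_integral_cong) (simp add: eq)
  finally show "(\<integral>\<^sup>+\<omega>. \<psi> (info S g t \<omega>, state S g t \<omega>, measurement S g (Suc t) \<omega>) \<partial>sample S) =
      (\<integral>\<^sup>+i. (\<integral>\<^sup>+z. \<psi> (i, z) \<partial>step_law S t (\<rho> t i) (g t i)) \<partial>info_law t)" .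
qed

lemma sets_step_law [simp]: "sets (step_law S t \<pi> u) = sets (state_space S t \<Otimes>\<^sub>M measurements S)"
  by (simp add: step_law_def)

lemma space_step_law [simp]: "space (step_law S t \<pi> u) = space (state_space S t \<Otimes>\<^sub>M measurements S)"
  by (simp add: step_law_def)

text \<open>Integrating \<open>X_t\<close> out of \<open>joint_law\<close> shows that
  \<open>joint_dens\<close> is the density of the information, \<open>Y_{t+1}\<close> and
  \<open>X_{t+1}\<close> with respect to the product of the information law and the two reference
  measures.\<close>

lemma joint_dens_law:
  assumes t: "t < horizon S"
    and f[measurable]: "f \<in> borel_measurable
      ((info_space S t \<Otimes>\<^sub>M measurements S) \<Otimes>\<^sub>M state_space S (Suc t))"
  shows "(\<integral>\<^sup>+\<omega>. f ((info S g t \<omega>, measurement S g (Suc t) \<omega>), state S g (Suc t) \<omega>) \<partial>sample S) =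
      (\<integral>\<^sup>+p. joint_dens t (fst (fst p)) (snd (fst p)) (snd p) * f p
         \<partial>((info_law t \<Otimes>\<^sub>M measurements S) \<Otimes>\<^sub>M state_space S (Suc t)))"
proof -
  let ?A = "info_space S t" and ?B = "state_space S t" and ?B' = "state_space S (Suc t)"
  let ?Y = "measurements S" and ?I = "info S g t"
  interpret B: sigma_finite_measure ?B using t by (intro sigma_finite_state) simp
  interpret B': sigma_finite_measure ?B' using t by (intro sigma_finite_state) simp
  note [measurable] = run_measurable[OF less_imp_le[OF t]]
  have "(\<lambda>p. joint_dens t (fst (fst p)) (snd (fst p)) (snd p)) \<in> borel_measurable ((?A \<Otimes>\<^sub>M ?Y) \<Otimes>\<^sub>M ?B')"
    using joint_dens_measurable[OF t] by (simp add: case_prod_beta')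
  then have Jf[measurable]: "(\<lambda>p. joint_dens t (fst (fst p)) (snd (fst p)) (snd p) * f p)
      \<in> borel_measurable ((?A \<Otimes>\<^sub>M ?Y) \<Otimes>\<^sub>M ?B')"
    by measurable
  have Jf1[measurable]: "(\<lambda>q. \<integral>\<^sup>+x'. joint_dens t (fst q) (snd q) x' * f (q, x') \<partial>?B') \<in> borel_measurable (?A \<Otimes>\<^sub>M ?Y)"
    using B'.borel_measurable_nn_integral_fst[OF Jf] by simp
  have Jf2[measurable]: "(\<lambda>i. \<integral>\<^sup>+y. (\<integral>\<^sup>+x'. joint_dens t i y x' * f ((i, y), x') \<partial>?B') \<partial>?Y) \<in> borel_measurable ?A"
    using measurements.borel_measurable_nn_integral_fst[OF Jf1] by simp
  have "(\<lambda>r. f ((fst (fst (fst r)), snd r), snd (fst r))) \<in> borel_measurable (((?A \<Otimes>\<^sub>M ?B) \<Otimes>\<^sub>M ?B') \<Otimes>\<^sub>M ?Y)"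
    by measurable
  from joint_law[OF t this]
  have "(\<integral>\<^sup>+\<omega>. f ((?I \<omega>, measurement S g (Suc t) \<omega>), state S g (Suc t) \<omega>) \<partial>sample S) =
     (\<integral>\<^sup>+\<omega>. (\<integral>\<^sup>+x. \<rho> t (?I \<omega>) x * (\<integral>\<^sup>+x'. trans_dens S t x (g t (?I \<omega>)) x' *
        (\<integral>\<^sup>+y. obs_dens S (Suc t) x' y * f ((?I \<omega>, y), x') \<partial>?Y) \<partial>?B') \<partial>?B) \<partial>sample S)"
    by simp
  also have "\<dots> = (\<integral>\<^sup>+\<omega>. (\<integral>\<^sup>+y. (\<integral>\<^sup>+x'. joint_dens t (?I \<omega>) y x' * f ((?I \<omega>, y), x') \<partial>?B') \<partial>?Y) \<partial>sample S)"
  proof (rule nn_integral_cong)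
    fix \<omega> assume "\<omega> \<in> space (sample S)"
    then have i: "?I \<omega> \<in> space ?A" using measurable_space[OF run_measurable(2)[OF less_imp_le[OF t]]] by simp
    have "(\<lambda>p. f ((?I \<omega>, fst p), snd p)) \<in> borel_measurable (?Y \<Otimes>\<^sub>M ?B')"
      using i by measurable
    from joint_dens_swap[OF t i this]
    show "(\<integral>\<^sup>+x. \<rho> t (?I \<omega>) x * (\<integral>\<^sup>+x'. trans_dens S t x (g t (?I \<omega>)) x' *
        (\<integral>\<^sup>+y. obs_dens S (Suc t) x' y * f ((?I \<omega>, y), x') \<partial>?Y) \<partial>?B') \<partial>?B) =
      (\<integral>\<^sup>+y. (\<integral>\<^sup>+x'. joint_dens t (?I \<omega>) y x' * f ((?I \<omega>, y), x') \<partial>?B') \<partial>?Y)"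
      by simp
  qed
  also have "\<dots> = (\<integral>\<^sup>+i. (\<integral>\<^sup>+y. (\<integral>\<^sup>+x'. joint_dens t i y x' * f ((i, y), x') \<partial>?B') \<partial>?Y) \<partial>info_law t)"
    unfolding info_law_def by (rule nn_integral_distr[symmetric]) auto
  also have "\<dots> = (\<integral>\<^sup>+q. (\<integral>\<^sup>+x'. joint_dens t (fst q) (snd q) x' * f (q, x') \<partial>?B') \<partial>(info_law t \<Otimes>\<^sub>M ?Y))"
    by (subst measurements.nn_integral_fst[symmetric]) (use Jf1 in \<open>auto cong: measurable_cong_sets sets_pair_measure_cong\<close>)
  also have "\<dots> = (\<integral>\<^sup>+p. joint_dens t (fst (fst p)) (snd (fst p)) (snd p) * f p \<partial>((info_law t \<Otimes>\<^sub>M ?Y) \<Otimes>\<^sub>M ?B'))"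
    by (subst B'.nn_integral_fst[symmetric]) (use Jf in \<open>auto cong: measurable_cong_sets sets_pair_measure_cong\<close>)
  finally show ?thesis .
qed

text \<open>The normalising integral of the update is itself the density of the observation under
  the kernel. Observations at which it vanishes thus have kernel measure zero, and division by zero
  does no harm.\<close>

lemma distr_step_law_obs:
  assumes t: "t < horizon S" and i: "i \<in> space (info_space S t)"
  shows "distr (step_law S t (\<rho> t i) (g t i)) (measurements S) snd =
     density (measurements S) (\<lambda>y. \<integral>\<^sup>+x'. joint_dens t i y x' \<partial>state_space S (Suc t))"
proof (rule measure_eqI)
  let ?B = "state_space S t" and ?B' = "state_space S (Suc t)" and ?Y = "measurements S"
  let ?K = "step_law S t (\<rho> t i) (g t i)"
  interpret B': sigma_finite_measure ?B' using t by (intro sigma_finite_state) simp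
  fix C assume "C \<in> sets (distr ?K ?Y snd)"
  then have C[measurable]: "C \<in> sets ?Y" by simp
  have "(\<lambda>p. joint_dens t (fst (fst p)) (snd (fst p)) (snd p)) \<in> borel_measurable ((info_space S t \<Otimes>\<^sub>M ?Y) \<Otimes>\<^sub>M ?B')"
    using joint_dens_measurable[OF t] by (simp add: case_prod_beta')
  from measurable_compose[OF _ this, of "\<lambda>q. ((i, fst q), snd q)" "?Y \<Otimes>\<^sub>M ?B'"]
  have [measurable]: "(\<lambda>(y, x'). joint_dens t i y x') \<in> borel_measurable (?Y \<Otimes>\<^sub>M ?B')"
    using i by (simp add: case_prod_beta')
  have snd: "snd \<in> ?K \<rightarrow>\<^sub>M ?Y" by (simp cong: measurable_cong_sets)
  have "emeasure (distr ?K ?Y snd) C = (\<integral>\<^sup>+z. indicator C (snd z) \<partial>?K)"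
    using snd by (simp add: nn_integral_distr[OF snd, symmetric])
  also have "\<dots> = (\<integral>\<^sup>+x. \<rho> t i x * (\<integral>\<^sup>+x'. trans_dens S t x (g t i) x' *
        (\<integral>\<^sup>+y. obs_dens S (Suc t) x' y * indicator C y \<partial>?Y) \<partial>?B') \<partial>?B)"
    by (subst nn_integral_step_law[OF t info_state_section[OF less_imp_le[OF t] i]
        measurable_space[OF strategy_measurable[OF t] i]]) auto
  also have "\<dots> = (\<integral>\<^sup>+y. (\<integral>\<^sup>+x'. joint_dens t i y x' * indicator C y \<partial>?B') \<partial>?Y)"
    using joint_dens_swap[OF t i, of "\<lambda>p. indicator C (fst p)"] by simp
  also have "\<dots> = (\<integral>\<^sup>+y\<in>C. (\<integral>\<^sup>+x'. joint_dens t i y x' \<partial>?B') \<partial>?Y)"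
    by (intro nn_integral_cong) (auto simp: indicator_def)
  also have "\<dots> = emeasure (density ?Y (\<lambda>y. \<integral>\<^sup>+x'. joint_dens t i y x' \<partial>?B')) C"
    by (rule emeasure_density[symmetric]) measurable
  finally show "emeasure (distr ?K ?Y snd) C = emeasure (density ?Y (\<lambda>y. \<integral>\<^sup>+x'. joint_dens t i y x' \<partial>?B')) C" .
qed simp

text \<open>The law of the information at \<open>t + 1\<close> is the mixture, over the law at
  \<open>t\<close>, of the images of the one-step kernels under \<open>next_info\<close>. A null set
  for the mixture is null for almost every component.\<close>

lemma AE_step_law_next_info:
  assumes t: "t < horizon S" and P: "AE i in info_law (Suc t). P i"
  shows "AE i in info_law t. AE z in step_law S t (\<rho> t i) (g t i). P (next_info S t i (g t i) (snd z))"
proof -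
  let ?A = "info_space S t" and ?B = "state_space S t" and ?Y = "measurements S"
  let ?n = "\<lambda>i z. next_info S t i (g t i) (snd z)"
  \<comment> \<open>\<open>P\<close> will be an inequality about \<open>V\<close> and need not
    define a measurable set; a measurable null set covering the exceptions is transported in its
    place.\<close>
  from P obtain N where N: "N \<in> null_sets (info_law (Suc t))" "{i \<in> space (info_law (Suc t)). \<not> P i} \<subseteq> N"
    unfolding eventually_ae_filter by auto
  have [measurable]: "N \<in> sets (info_space S (Suc t))" using N(1) by (auto simp: null_sets_def)
  have n[measurable]: "(\<lambda>p. ?n (fst p) (snd p)) \<in> ?A \<Otimes>\<^sub>M ?B \<Otimes>\<^sub>M ?Y \<rightarrow>\<^sub>M info_space S (Suc t)"
    by (intro measurable_next_info delay measurable_compose[OF _ strategy_measurable[OF t]]) measurable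
  have "(\<lambda>p. indicator N (?n (fst p) (snd p)) :: ennreal) \<in> borel_measurable (?A \<Otimes>\<^sub>M ?B \<Otimes>\<^sub>M ?Y)"
    by measurable
  note dis = step_disintegration[OF t this]
  have "(\<integral>\<^sup>+i. (\<integral>\<^sup>+z. indicator N (?n i z) \<partial>step_law S t (\<rho> t i) (g t i)) \<partial>info_law t) =
      (\<integral>\<^sup>+\<omega>. indicator N (info S g (Suc t) \<omega>) \<partial>sample S)"
    using dis(2) info_Suc_control[OF t] by (simp cong: nn_integral_cong)
  also have "\<dots> = emeasure (info_law (Suc t)) N"
    unfolding info_law_def using t
    by (subst nn_integral_distr[OF run_measurable(2), symmetric]) auto
  also have "\<dots> = 0" using N(1) by auto
  finally have "AE i in info_law t. (\<integral>\<^sup>+z. indicator N (?n i z) \<partial>step_law S t (\<rho> t i) (g t i)) = 0"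
    using dis(1) by (subst (asm) nn_integral_0_iff_AE) (auto cong: measurable_cong_sets)
  moreover have "AE i in info_law t. i \<in> space ?A" using AE_space[of "info_law t"] by simp
  ultimately show ?thesis
  proof eventually_elim
    case (elim i)
    let ?K = "step_law S t (\<rho> t i) (g t i)"
    have ni: "?n i \<in> ?K \<rightarrow>\<^sub>M info_space S (Suc t)"
      using measurable_compose[OF measurable_Pair1'[OF elim(2)] n] by (simp cong: measurable_cong_sets)
    have "AE z in ?K. indicator N (?n i z) = (0::ennreal)"
      using elim(1) ni by (subst (asm) nn_integral_0_iff_AE) auto
    moreover have "AE z in ?K. ?n i z \<in> space (info_space S (Suc t))"
      by (rule AE_I2) (rule measurable_space[OF ni])
    ultimately show ?case
      by eventually_elim (use N(2) in \<open>auto simp: indicator_def split: if_splits\<close>)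
  qed
qed

section \<open>Bayes' rule\<close>


text \<open>Two densities of the same joint law must agree almost everywhere: the numerator of the
  update, and the marginal density of the observation times the conditional density of
  \<open>X_{t+1}\<close> given the next information. The product form avoids division and hence any
  condition on the normaliser.\<close>

lemma joint_dens_bayes:
  assumes t: "t < horizon S"
  shows "AE i in info_law t. AE y in measurements S. AE x' in state_space S (Suc t).
     joint_dens t i y x' = (\<integral>\<^sup>+x''. joint_dens t i y x'' \<partial>state_space S (Suc t)) *
       \<rho> (Suc t) (next_info S t i (g t i) y) x'"
proof -
  let ?A = "info_space S t" and ?A' = "info_space S (Suc t)" and ?B' = "state_space S (Suc t)"
  let ?Y = "measurements S" and ?I = "info S g t" and ?I' = "info S g (Suc t)"
  let ?W = "(info_law t \<Otimes>\<^sub>M ?Y) \<Otimes>\<^sub>M ?B'"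
  interpret B': sigma_finite_measure ?B' using t by (intro sigma_finite_state) simp
  interpret L: prob_space "info_law t" using t by (intro prob_space_info_law) simp
  interpret LY: pair_sigma_finite "info_law t" ?Y ..
  interpret LYB': pair_sigma_finite "info_law t \<Otimes>\<^sub>M ?Y" ?B' ..
  define N where "N = (\<lambda>p. joint_dens t (fst (fst p)) (snd (fst p)) (snd p))"
  define Z where "Z = (\<lambda>q. \<integral>\<^sup>+x'. N (q, x') \<partial>?B')"
  define n where "n = (\<lambda>q. next_info S t (fst q) (g t (fst q)) (snd q))"
  have sW: "sets ?W = sets ((?A \<Otimes>\<^sub>M ?Y) \<Otimes>\<^sub>M ?B')" by (intro sets_pair_measure_cong) auto
  have N[measurable]: "N \<in> borel_measurable ((?A \<Otimes>\<^sub>M ?Y) \<Otimes>\<^sub>M ?B')"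
    using joint_dens_measurable[OF t] by (simp add: case_prod_beta' N_def)
  have [measurable]: "Z \<in> borel_measurable (?A \<Otimes>\<^sub>M ?Y)"
    unfolding Z_def by (rule B'.borel_measurable_nn_integral_fst[OF N])
  have [measurable]: "n \<in> ?A \<Otimes>\<^sub>M ?Y \<rightarrow>\<^sub>M ?A'"
    using next_info_measurable[OF t] by (simp add: n_def case_prod_beta')
  have [measurable]: "(\<lambda>(i, x). \<rho> (Suc t) i x) \<in> borel_measurable (?A' \<Otimes>\<^sub>M ?B')"
    by (rule info_state_measurable[OF Suc_leI[OF t]])
  note [measurable] = measurable_prev_info[OF delay]
  define R where "R = (\<lambda>p. Z (fst p) * \<rho> (Suc t) (n (fst p)) (snd p))"
  have R[measurable]: "R \<in> borel_measurable ((?A \<Otimes>\<^sub>M ?Y) \<Otimes>\<^sub>M ?B')" unfolding R_def by measurable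
  have "AE p in ?W. N p = R p"
  proof (rule sigma_finite_measure.density_unique2[OF LYB'.sigma_finite_measure_axioms])
    fix C assume "C \<in> sets ?W"
    then have C[measurable]: "C \<in> sets ((?A \<Otimes>\<^sub>M ?Y) \<Otimes>\<^sub>M ?B')" using sW by simp
    \<comment> \<open>For the next information \<open>n q\<close>, this is the conditional
      probability that \<open>X_{t+1}\<close> lies in the section of \<open>C\<close> at
      \<open>q\<close>.\<close>
    define F where "F = (\<lambda>q. \<integral>\<^sup>+x'. \<rho> (Suc t) (n q) x' * indicator C (q, x') \<partial>?B')"
    have [measurable]: "F \<in> borel_measurable (?A \<Otimes>\<^sub>M ?Y)" unfolding F_def by measurable
    have inv: "?I' \<omega> = n (?I \<omega>, measurement S g (Suc t) \<omega>)"
      "prev_info S t (?I' \<omega>) = (?I \<omega>, measurement S g (Suc t) \<omega>)"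
      if \<omega>: "\<omega> \<in> space (sample S)" for \<omega>
    proof -
      show "?I' \<omega> = n (?I \<omega>, measurement S g (Suc t) \<omega>)"
        using info_Suc_control[OF t \<omega>] by (simp add: n_def)
      have "?I \<omega> \<in> space ?A" "measurement S g (Suc t) \<omega> \<in> space ?Y"
        using measurable_space[OF run_measurable(2) \<omega>] measurable_space[OF run_measurable(3) \<omega>] t by auto
      then show "prev_info S t (?I' \<omega>) = (?I \<omega>, measurement S g (Suc t) \<omega>)"
        unfolding info_Suc_control[OF t \<omega>]
        using measurable_space[OF strategy_measurable[OF t]] by (intro prev_next_info delay) auto
    qed
    have "(\<integral>\<^sup>+p\<in>C. N p \<partial>?W) =
        (\<integral>\<^sup>+\<omega>. indicator C ((?I \<omega>, measurement S g (Suc t) \<omega>), state S g (Suc t) \<omega>) \<partial>sample S)"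
      unfolding N_def by (rule joint_dens_law[OF t, symmetric]) measurable
    \<comment> \<open>Decoding expresses the event through the information at \<open>t + 1\<close>,
      which is what the information state at that time conditions on.\<close>
    also have "\<dots> = (\<integral>\<^sup>+\<omega>. indicator C (prev_info S t (?I' \<omega>), state S g (Suc t) \<omega>) \<partial>sample S)"
      by (rule nn_integral_cong) (simp add: inv(2))
    also have "\<dots> = (\<integral>\<^sup>+\<omega>. (\<integral>\<^sup>+x'. \<rho> (Suc t) (?I' \<omega>) x' * indicator C (prev_info S t (?I' \<omega>), x') \<partial>?B') \<partial>sample S)"
      using information_state_disintegration[OF team info_state strategy Suc_leI[OF t],
          of "\<lambda>p. indicator C (prev_info S t (fst p), snd p)"] by simp
    also have "\<dots> = (\<integral>\<^sup>+\<omega>. F (?I \<omega>, measurement S g (Suc t) \<omega>) \<partial>sample S)"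
      by (rule nn_integral_cong) (simp add: inv(2) F_def, simp add: inv(1))
    also have "\<dots> = (\<integral>\<^sup>+p. N p * F (fst p) \<partial>?W)"
      unfolding N_def using joint_dens_law[OF t, of "\<lambda>p. F (fst p)"] by simp
    also have "\<dots> = (\<integral>\<^sup>+q. (\<integral>\<^sup>+x'. N (q, x') * F q \<partial>?B') \<partial>(info_law t \<Otimes>\<^sub>M ?Y))"
      by (subst B'.nn_integral_fst[symmetric]) (auto simp: measurable_cong_sets[OF sW refl])
    \<comment> \<open>\<open>F q\<close> does not involve \<open>x'\<close>, so the integral of
      \<open>N\<close> collapses to \<open>Z q\<close>; then \<open>Z q\<close> times the
      conditional density is \<open>R\<close>.\<close>
    also have "\<dots> = (\<integral>\<^sup>+q. (\<integral>\<^sup>+x'. R (q, x') * indicator C (q, x') \<partial>?B') \<partial>(info_law t \<Otimes>\<^sub>M ?Y))"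
    proof (rule nn_integral_cong)
      fix q assume "q \<in> space (info_law t \<Otimes>\<^sub>M ?Y)"
      then have q: "q \<in> space (?A \<Otimes>\<^sub>M ?Y)" by (simp add: space_pair_measure)
      have [measurable]: "(\<lambda>x'. N (q, x')) \<in> borel_measurable ?B'"
        by (rule measurable_compose[OF measurable_Pair1'[OF q] N])
      have [measurable]: "(\<lambda>x'. \<rho> (Suc t) (n q) x' * indicator C (q, x')) \<in> borel_measurable ?B'"
        using q by measurable
      show "(\<integral>\<^sup>+x'. N (q, x') * F q \<partial>?B') = (\<integral>\<^sup>+x'. R (q, x') * indicator C (q, x') \<partial>?B')"
        unfolding F_def R_def
        by (subst nn_integral_multc) (auto simp: Z_def mult.assoc nn_integral_cmult[symmetric])
    qed
    also have "\<dots> = (\<integral>\<^sup>+p\<in>C. R p \<partial>?W)"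
      by (subst B'.nn_integral_fst[symmetric]) (auto simp: measurable_cong_sets[OF sW refl])
    finally show "(\<integral>\<^sup>+p\<in>C. N p \<partial>?W) = (\<integral>\<^sup>+p\<in>C. R p \<partial>?W)" .
  qed (simp_all add: measurable_cong_sets[OF sW refl])
  from LY.AE_pair[OF LYB'.AE_pair[OF this]] show ?thesis
    by (simp add: N_def R_def Z_def n_def)
qed

text \<open>The normaliser integrates to 1 over the information law and the observations, being a
  marginal of a probability density. Finiteness is one of the two conditions for cancelling it in
  extended nonnegative reals.\<close>

lemma nn_integral_joint_dens_finite:
  assumes t: "t < horizon S"
  shows "AE i in info_law t. AE y in measurements S.
     (\<integral>\<^sup>+x'. joint_dens t i y x' \<partial>state_space S (Suc t)) \<noteq> \<top>"
proof -
  let ?A = "info_space S t" and ?B' = "state_space S (Suc t)" and ?Y = "measurements S"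
  interpret B': sigma_finite_measure ?B' using t by (intro sigma_finite_state) simp
  interpret L: prob_space "info_law t" using t by (intro prob_space_info_law) simp
  interpret LY: pair_sigma_finite "info_law t" ?Y ..
  have sLY: "sets (info_law t \<Otimes>\<^sub>M ?Y) = sets (?A \<Otimes>\<^sub>M ?Y)"
    and sW: "sets ((info_law t \<Otimes>\<^sub>M ?Y) \<Otimes>\<^sub>M ?B') = sets ((?A \<Otimes>\<^sub>M ?Y) \<Otimes>\<^sub>M ?B')"
    by (intro sets_pair_measure_cong; simp)+
  have N: "(\<lambda>p. joint_dens t (fst (fst p)) (snd (fst p)) (snd p))
      \<in> borel_measurable ((?A \<Otimes>\<^sub>M ?Y) \<Otimes>\<^sub>M ?B')"
    using joint_dens_measurable[OF t] by (simp add: case_prod_beta')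
  let ?Z = "\<lambda>q. \<integral>\<^sup>+x'. joint_dens t (fst q) (snd q) x' \<partial>?B'"
  have Z: "?Z \<in> borel_measurable (info_law t \<Otimes>\<^sub>M ?Y)"
    using B'.borel_measurable_nn_integral_fst[OF N] by (simp add: measurable_cong_sets[OF sLY refl])
  have "(\<integral>\<^sup>+q. ?Z q \<partial>(info_law t \<Otimes>\<^sub>M ?Y)) = 1"
    using joint_dens_law[OF t, of "\<lambda>_. 1"] N
      B'.nn_integral_fst[of "\<lambda>p. joint_dens t (fst (fst p)) (snd (fst p)) (snd p)" "info_law t \<Otimes>\<^sub>M ?Y"]
    by (simp add: measurable_cong_sets[OF sW refl] sample.emeasure_space_1)
  then have "AE q in info_law t \<Otimes>\<^sub>M ?Y. ?Z q \<noteq> \<infinity>"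
    using Z by (intro nn_integral_PInf_AE) auto
  from LY.AE_pair[OF this] show ?thesis by simp
qed

text \<open>Divide \<open>joint_dens_bayes\<close> by the normaliser where that is positive and
  finite. The claim concerns only the decision \<open>g t i\<close>, for which the closed loop
  provides a joint law.\<close>

lemma update_eq_info_state:
  assumes t: "t < horizon S"
  shows "AE i in info_law t. AE z in step_law S t (\<rho> t i) (g t i). AE x' in state_space S (Suc t).
     update S t (\<rho> t i) (snd z) (g t i) x' = \<rho> (Suc t) (next_info S t i (g t i) (snd z)) x'"
proof -
  let ?A = "info_space S t" and ?B' = "state_space S (Suc t)" and ?Y = "measurements S"
  interpret B': sigma_finite_measure ?B' using t by (intro sigma_finite_state) simp
  have "AE i in info_law t. i \<in> space ?A" using AE_space[of "info_law t"] by simp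
  with joint_dens_bayes[OF t] nn_integral_joint_dens_finite[OF t] show ?thesis
  proof eventually_elim
    case (elim i)
    let ?Z = "\<lambda>y. \<integral>\<^sup>+x'. joint_dens t i y x' \<partial>?B'"
    let ?P = "\<lambda>y. AE x' in ?B'. update S t (\<rho> t i) y (g t i) x' = \<rho> (Suc t) (next_info S t i (g t i) y) x'"
    have N: "(\<lambda>p. joint_dens t (fst (fst p)) (snd (fst p)) (snd p))
        \<in> borel_measurable ((?A \<Otimes>\<^sub>M ?Y) \<Otimes>\<^sub>M ?B')"
      using joint_dens_measurable[OF t] by (simp add: case_prod_beta')
    from measurable_compose[OF measurable_Pair1'[OF elim(3)] B'.borel_measurable_nn_integral_fst[OF N]]
    have Z: "?Z \<in> borel_measurable ?Y" by simp
    \<comment> \<open>Positivity is kept as a premise because almost everywhere for a measure with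
      density \<open>?Z\<close> means almost everywhere in this conditional form.\<close>
    have "AE y in ?Y. 0 < ?Z y \<longrightarrow> ?P y"
      using elim(1,2)
    proof eventually_elim
      case (elim y)
      show ?case
      proof
        assume pos: "0 < ?Z y"
        from elim(1) show "?P y"
        proof eventually_elim
          case (elim x')
          have "update S t (\<rho> t i) y (g t i) x' = joint_dens t i y x' / ?Z y"
            by (simp add: update_def joint_dens_def)
          also have "\<dots> = \<rho> (Suc t) (next_info S t i (g t i) y) x'"
            unfolding elim using pos \<open>?Z y \<noteq> \<top>\<close>
            by (subst mult.commute, intro ennreal_mult_divide_eq) auto
          finally show ?case .
        qed
      qed
    qed
    then have "AE y in distr (step_law S t (\<rho> t i) (g t i)) ?Y snd. ?P y"
      unfolding distr_step_law_obs[OF t elim(3)] AE_density[OF Z] .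
    then show ?case
      by (rule AE_distrD[rotated]) (simp cong: measurable_cong_sets)
  qed
qed

section \<open>Dynamic programming\<close>

definition total_cost :: "nat \<Rightarrow> 'a \<Rightarrow> real" where
  "total_cost t \<omega> = (\<Sum>l\<in>{t..<horizon S}. stage_cost S l (state S g l \<omega>) (control S g l \<omega>))
     + final_cost S (state S g (horizon S) \<omega>)"

text \<open>A single unfolding settles it: both the kernel and the update are literally unchanged,
  so the continuation values on the two sides have identical arguments.\<close>

lemma value_function_cong:
  fixes V :: "nat \<Rightarrow> ('x \<Rightarrow> ennreal) \<Rightarrow> ereal"
  assumes V_final: "\<And>\<pi>. V (horizon S) \<pi> =
        ext_expectation (density (state_space S (horizon S)) \<pi>) (\<lambda>x. ereal (final_cost S x))"
    and V_step: "\<And>s \<pi>. s < horizon S \<Longrightarrow> V s \<pi> =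
        (INF u\<in>space (controls S s).
           ext_expectation (step_law S s \<pi> u)
             (\<lambda>(x, y). ereal (stage_cost S s x u) + V (Suc s) (update S s \<pi> y u)))"
    and s: "s \<le> horizon S" and eq: "AE x in state_space S s. \<pi> x = \<pi>' x"
  shows "V s \<pi> = V s \<pi>'"
proof (cases "s = horizon S")
  case True
  then show ?thesis using density_cong_AE[OF eq] by (simp add: V_final)
next
  case False
  then have "s < horizon S" using s by simp
  then show ?thesis by (simp add: V_step step_law_cong_AE[OF eq] update_cong_AE[OF eq])
qed

text \<open>Everything is stated under the law of the information rather than on the sample space:
  the value function need not be measurable, so a null set of the sample space on which the
  inequality fails could not be transported through the one-step kernel.\<close>

lemma value_le_cost:
  fixes V :: "nat \<Rightarrow> ('x \<Rightarrow> ennreal) \<Rightarrow> ereal"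
  assumes V_final: "\<And>\<pi>. V (horizon S) \<pi> =
        ext_expectation (density (state_space S (horizon S)) \<pi>) (\<lambda>x. ereal (final_cost S x))"
    and V_step: "\<And>s \<pi>. s < horizon S \<Longrightarrow> V s \<pi> =
        (INF u\<in>space (controls S s).
           ext_expectation (step_law S s \<pi> u)
             (\<lambda>(x, y). ereal (stage_cost S s x u) + V (Suc s) (update S s \<pi> y u)))"
    and int_stage: "\<And>l. t \<le> l \<Longrightarrow> l < horizon S \<Longrightarrow>
        integrable (sample S) (\<lambda>\<omega>. stage_cost S l (state S g l \<omega>) (control S g l \<omega>))"
    and int_final: "integrable (sample S) (\<lambda>\<omega>. final_cost S (state S g (horizon S) \<omega>))"
    and t: "t \<le> horizon S"
  shows "\<exists>j\<in>borel_measurable (info_space S t). integrable (info_law t) j \<and>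
     (AE i in info_law t. V t (\<rho> t i) \<le> ereal (j i)) \<and>
     (\<forall>a\<in>sets (info_space S t). (\<integral>\<omega>. indicator a (info S g t \<omega>) * total_cost t \<omega> \<partial>sample S) =
        (\<integral>i. indicator a i * j i \<partial>info_law t))"
\<comment> \<open>Downward from the horizon to \<open>t\<close>. The witness \<open>j\<close> is a
  version of the cost-to-go written as a function of the information; at the horizon it is the mean
  of the final cost under the information state.\<close>
proof (rule inc_induct[OF t])
  let ?T = "horizon S"
  have final_M: "final_cost S \<in> borel_measurable (state_space S ?T)"
    using team by (simp add: delayed_sharing_team_def)
  define h where "h = (\<lambda>p :: ('y, 'u) info \<times> 'x. final_cost S (snd p))"
  have h: "h \<in> borel_measurable (info_space S ?T \<Otimes>\<^sub>M state_space S ?T)"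
    unfolding h_def by (rule measurable_compose[OF measurable_snd final_M])
  have "integrable (sample S) (\<lambda>\<omega>. h (info S g ?T \<omega>, state S g ?T \<omega>))"
    using int_final by (simp add: h_def)
  note dis = disintegrate_integral[where \<kappa>="\<lambda>i. density (state_space S ?T) (\<rho> ?T i)",
      OF run_measurable(2)[OF order_refl] run_measurable(1)[OF order_refl] sets_density
        state_disintegration[OF order_refl, unfolded info_law_def] h this, folded info_law_def]
  obtain j where j: "j \<in> borel_measurable (info_space S ?T)" "integrable (info_law ?T) j"
    "AE i in info_law ?T. integrable (density (state_space S ?T) (\<rho> ?T i)) (\<lambda>x. h (i, x)) \<and>
       (\<integral>x. h (i, x) \<partial>density (state_space S ?T) (\<rho> ?T i)) = j i"
    "\<And>a. a \<in> sets (info_space S ?T) \<Longrightarrow>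
       (\<integral>\<omega>. indicator a (info S g ?T \<omega>) * h (info S g ?T \<omega>, state S g ?T \<omega>) \<partial>sample S) =
       (\<integral>i. indicator a i * j i \<partial>info_law ?T)"
    using dis by blast
  from j(3) have "AE i in info_law ?T. V ?T (\<rho> ?T i) \<le> ereal (j i)"
    by eventually_elim (auto simp: V_final ext_expectation_eq_integral h_def)
  with j show "\<exists>j\<in>borel_measurable (info_space S ?T). integrable (info_law ?T) j \<and>
     (AE i in info_law ?T. V ?T (\<rho> ?T i) \<le> ereal (j i)) \<and>
     (\<forall>a\<in>sets (info_space S ?T). (\<integral>\<omega>. indicator a (info S g ?T \<omega>) * total_cost ?T \<omega> \<partial>sample S) =
        (\<integral>i. indicator a i * j i \<partial>info_law ?T))"
    by (auto simp: total_cost_def h_def)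
next
  fix s
  let ?A = "info_space S s" and ?A' = "info_space S (Suc s)" and ?B = "state_space S s"
  let ?Y = "measurements S" and ?I = "info S g s" and ?I' = "info S g (Suc s)" and ?X = "state S g s"
  let ?K = "\<lambda>i. step_law S s (\<rho> s i) (g s i)"
  assume s: "t \<le> s" "s < horizon S"
    and IH: "\<exists>j\<in>borel_measurable ?A'. integrable (info_law (Suc s)) j \<and>
     (AE i in info_law (Suc s). V (Suc s) (\<rho> (Suc s) i) \<le> ereal (j i)) \<and>
     (\<forall>a\<in>sets ?A'. (\<integral>\<omega>. indicator a (?I' \<omega>) * total_cost (Suc s) \<omega> \<partial>sample S) =
        (\<integral>i. indicator a i * j i \<partial>info_law (Suc s)))"
  from IH obtain j' where j'[measurable]: "j' \<in> borel_measurable ?A'"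
    and int_j': "integrable (info_law (Suc s)) j'"
    and V_j': "AE i in info_law (Suc s). V (Suc s) (\<rho> (Suc s) i) \<le> ereal (j' i)"
    and C_j': "\<And>a. a \<in> sets ?A' \<Longrightarrow>
        (\<integral>\<omega>. indicator a (?I' \<omega>) * total_cost (Suc s) \<omega> \<partial>sample S) =
        (\<integral>i. indicator a i * j' i \<partial>info_law (Suc s))" by blast
  have sle: "s \<le> horizon S" "Suc s \<le> horizon S" using s by auto
  note [measurable] = strategy_measurable[OF s(2)] run_measurable[OF sle(1)] run_measurable[OF sle(2)]
  note I' = info_Suc_control[OF s(2)]
  have cost: "(\<lambda>(x, u). stage_cost S s x u) \<in> borel_measurable (?B \<Otimes>\<^sub>M controls S s)"
    using team s(2) by (simp add: delayed_sharing_team_def)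
  \<comment> \<open>The continuation value is replaced by its measurable majorant \<open>j'\<close>,
    evaluated at the next information, so that the one-step cost can be disintegrated.\<close>
  define h where "h = (\<lambda>p. stage_cost S s (fst (snd p)) (g s (fst p)) +
      j' (next_info S s (fst p) (g s (fst p)) (snd (snd p))))"
  have n[measurable]: "(\<lambda>p. next_info S s (fst p) (g s (fst p)) (snd (snd p))) \<in> ?A \<Otimes>\<^sub>M ?B \<Otimes>\<^sub>M ?Y \<rightarrow>\<^sub>M ?A'"
    by (intro measurable_next_info delay measurable_compose[OF _ strategy_measurable[OF s(2)]]) measurable
  have "(\<lambda>p. (fst (snd p), g s (fst p))) \<in> ?A \<Otimes>\<^sub>M ?B \<Otimes>\<^sub>M ?Y \<rightarrow>\<^sub>M ?B \<Otimes>\<^sub>M controls S s"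
    by measurable
  from measurable_compose[OF this cost]
  have [measurable]: "(\<lambda>p. stage_cost S s (fst (snd p)) (g s (fst p))) \<in> borel_measurable (?A \<Otimes>\<^sub>M ?B \<Otimes>\<^sub>M ?Y)"
    by simp
  have h: "h \<in> borel_measurable (?A \<Otimes>\<^sub>M ?B \<Otimes>\<^sub>M ?Y)" unfolding h_def by measurable
  have hI: "h (?I \<omega>, ?X \<omega>, measurement S g (Suc s) \<omega>) =
      stage_cost S s (?X \<omega>) (control S g s \<omega>) + j' (?I' \<omega>)" if "\<omega> \<in> space (sample S)" for \<omega>
    using I'[OF that] by (simp add: h_def control_def)
  have int_s: "integrable (sample S) (\<lambda>\<omega>. stage_cost S s (?X \<omega>) (control S g s \<omega>))"
    by (rule int_stage) (use s in auto)
  have int_jI: "integrable (sample S) (\<lambda>\<omega>. j' (?I' \<omega>))"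
    using int_j' unfolding info_law_def by (subst (asm) integrable_distr_eq) auto
  have int_tot: "integrable (sample S) (total_cost (Suc s))"
    unfolding total_cost_def[abs_def] using s int_stage int_final
    by (intro Bochner_Integration.integrable_add Bochner_Integration.integrable_sum) auto
  have ind: "integrable (sample S) (\<lambda>\<omega>. indicator a (?I \<omega>) * f \<omega>)"
    if a[measurable]: "a \<in> sets ?A" and f: "integrable (sample S) f" for a and f :: "'a \<Rightarrow> real"
  proof (rule Bochner_Integration.integrable_bound[OF f])
    have [measurable]: "f \<in> borel_measurable (sample S)" using f by simp
    show "(\<lambda>\<omega>. indicator a (?I \<omega>) * f \<omega>) \<in> borel_measurable (sample S)" by measurable
  qed (auto simp: indicator_def)
  have "integrable (sample S) (\<lambda>\<omega>. h (?I \<omega>, ?X \<omega>, measurement S g (Suc s) \<omega>))"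
    using Bochner_Integration.integrable_add[OF int_s int_jI] hI
    by (simp cong: Bochner_Integration.integrable_cong)
  note dis = disintegrate_integral[where \<kappa>="?K",
      OF run_measurable(2)[OF sle(1)] measurable_Pair[OF run_measurable(1)[OF sle(1)] run_measurable(3)[OF sle(2)]]
        sets_step_law step_disintegration[OF s(2), unfolded info_law_def] h this, folded info_law_def]
  obtain j where j: "j \<in> borel_measurable ?A" "integrable (info_law s) j"
    "AE i in info_law s. integrable (?K i) (\<lambda>z. h (i, z)) \<and> (\<integral>z. h (i, z) \<partial>?K i) = j i"
    "\<And>a. a \<in> sets ?A \<Longrightarrow>
       (\<integral>\<omega>. indicator a (?I \<omega>) * h (?I \<omega>, ?X \<omega>, measurement S g (Suc s) \<omega>) \<partial>sample S) =
       (\<integral>i. indicator a i * j i \<partial>info_law s)"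
    using dis by blast
  have "AE i in info_law s. i \<in> space ?A" using AE_space[of "info_law s"] by simp
  with j(3) AE_step_law_next_info[OF s(2) V_j'] update_eq_info_state[OF s(2)]
  have "AE i in info_law s. V s (\<rho> s i) \<le> ereal (j i)"
  proof eventually_elim
    case (elim i)
    have u: "g s i \<in> space (controls S s)" using measurable_space[OF strategy_measurable[OF s(2)] elim(4)] .
    have "V s (\<rho> s i) \<le> ext_expectation (?K i)
        (\<lambda>(x, y). ereal (stage_cost S s x (g s i)) + V (Suc s) (update S s (\<rho> s i) y (g s i)))"
      unfolding V_step[OF s(2)] by (rule INF_lower[OF u])
    also have "\<dots> \<le> ext_expectation (?K i) (\<lambda>z. ereal (h (i, z)))"
    proof (rule ext_expectation_mono_AE)
      show "AE z in ?K i. (case z of (x, y) \<Rightarrow> ereal (stage_cost S s x (g s i)) +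
          V (Suc s) (update S s (\<rho> s i) y (g s i))) \<le> ereal (h (i, z))"
        using elim(2,3)
      proof eventually_elim
        case (elim z)
        \<comment> \<open>The recursion evaluates \<open>V\<close> at the update, the induction
          hypothesis bounds it at the information state; the two densities agree almost everywhere,
          so \<open>V\<close> does not distinguish them.\<close>
        have "V (Suc s) (update S s (\<rho> s i) (snd z) (g s i)) \<le> ereal (j' (next_info S s i (g s i) (snd z)))"
          using value_function_cong[of V, OF V_final V_step sle(2) elim(2)] elim(1) by simp
        then show ?case
          by (auto simp: h_def split_beta plus_ereal.simps(1)[symmetric] simp del: plus_ereal.simps intro: add_left_mono)
      qed
    qed
    also have "\<dots> = ereal (j i)" using elim(1) by (simp add: ext_expectation_eq_integral)
    finally show ?case .
  qed
  moreover have "(\<integral>\<omega>. indicator a (?I \<omega>) * total_cost s \<omega> \<partial>sample S) = (\<integral>i. indicator a i * j i \<partial>info_law s)"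
    if a[measurable]: "a \<in> sets ?A" for a
  proof -
    \<comment> \<open>Tower property: an event of the information at \<open>s\<close> is pulled back
      along \<open>prev_info\<close> to an event of the information at \<open>s + 1\<close>, where
      the induction hypothesis supplies the integral.\<close>
    define a' where "a' = (\<lambda>i'. fst (prev_info S s i')) -` a \<inter> space ?A'"
    have a'[measurable]: "a' \<in> sets ?A'"
      unfolding a'_def
      by (rule measurable_sets[OF measurable_compose[OF measurable_prev_info[OF delay] measurable_fst] a])
    have ia: "indicator a' (?I' \<omega>) = (indicator a (?I \<omega>) :: real)" if \<omega>: "\<omega> \<in> space (sample S)" for \<omega>
    proof -
      have sp: "?I \<omega> \<in> space ?A" "?I' \<omega> \<in> space ?A'" "measurement S g (Suc s) \<omega> \<in> space ?Y"
        using measurable_space[OF run_measurable(2) \<omega>] measurable_space[OF run_measurable(3) \<omega>] sle by auto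
      then have "prev_info S s (?I' \<omega>) = (?I \<omega>, measurement S g (Suc s) \<omega>)"
        unfolding I'[OF \<omega>]
        using measurable_space[OF strategy_measurable[OF s(2)]] by (intro prev_next_info delay) auto
      then show ?thesis using sp by (simp add: a'_def indicator_def)
    qed
    have "(\<integral>\<omega>. indicator a (?I \<omega>) * total_cost (Suc s) \<omega> \<partial>sample S) =
        (\<integral>\<omega>. indicator a' (?I' \<omega>) * total_cost (Suc s) \<omega> \<partial>sample S)"
      by (rule Bochner_Integration.integral_cong) (simp_all add: ia)
    also have "\<dots> = (\<integral>\<omega>. indicator a' (?I' \<omega>) * j' (?I' \<omega>) \<partial>sample S)"
      unfolding C_j'[OF a'] info_law_def by (rule integral_distr) measurable
    also have "\<dots> = (\<integral>\<omega>. indicator a (?I \<omega>) * j' (?I' \<omega>) \<partial>sample S)"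
      by (rule Bochner_Integration.integral_cong) (simp_all add: ia)
    finally have tail: "(\<integral>\<omega>. indicator a (?I \<omega>) * total_cost (Suc s) \<omega> \<partial>sample S) =
        (\<integral>\<omega>. indicator a (?I \<omega>) * j' (?I' \<omega>) \<partial>sample S)" .
    have "total_cost s \<omega> = stage_cost S s (?X \<omega>) (control S g s \<omega>) + total_cost (Suc s) \<omega>" for \<omega>
      using s(2) by (simp add: total_cost_def sum.atLeast_Suc_lessThan)
    then have "(\<integral>\<omega>. indicator a (?I \<omega>) * total_cost s \<omega> \<partial>sample S) =
        (\<integral>\<omega>. indicator a (?I \<omega>) * stage_cost S s (?X \<omega>) (control S g s \<omega>) \<partial>sample S) +
        (\<integral>\<omega>. indicator a (?I \<omega>) * total_cost (Suc s) \<omega> \<partial>sample S)"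
      using ind[OF a int_s] ind[OF a int_tot] by (simp add: distrib_left)
    also have "\<dots> = (\<integral>\<omega>. indicator a (?I \<omega>) * h (?I \<omega>, ?X \<omega>, measurement S g (Suc s) \<omega>) \<partial>sample S)"
      unfolding tail Bochner_Integration.integral_add[OF ind[OF a int_s] ind[OF a int_jI], symmetric]
      by (rule Bochner_Integration.integral_cong) (simp_all add: hI distrib_left)
    also have "\<dots> = (\<integral>i. indicator a i * j i \<partial>info_law s)" by (rule j(4)[OF a])
    finally show ?thesis .
  qed
  ultimately show "\<exists>j\<in>borel_measurable ?A. integrable (info_law s) j \<and>
     (AE i in info_law s. V s (\<rho> s i) \<le> ereal (j i)) \<and>
     (\<forall>a\<in>sets ?A. (\<integral>\<omega>. indicator a (?I \<omega>) * total_cost s \<omega> \<partial>sample S) =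
        (\<integral>i. indicator a i * j i \<partial>info_law s))"
    using j(1,2) by blast
qed

text \<open>Every event of the information algebra is the preimage of a measurable set of
  information values, so the integral identities carried by the induction are exactly the defining
  property of the conditional expectation.\<close>

lemma cost_to_go_charact:
  assumes t: "t \<le> horizon S" and j: "j \<in> borel_measurable (info_space S t)" "integrable (info_law t) j"
    and C: "integrable (sample S) (total_cost t)"
    and eq: "\<And>a. a \<in> sets (info_space S t) \<Longrightarrow>
        (\<integral>\<omega>. indicator a (info S g t \<omega>) * total_cost t \<omega> \<partial>sample S) = (\<integral>i. indicator a i * j i \<partial>info_law t)"
  shows "AE \<omega> in sample S. cost_to_go S g t \<omega> = j (info S g t \<omega>)"
proof -
  let ?M = "sample S" and ?I = "info S g t" and ?A = "info_space S t"
  note [measurable] = run_measurable(2)[OF t] j(1)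
  have "subalgebra ?M (info_algebra S g t)"
    unfolding subalgebra_def info_algebra_def by (simp add: sets_image_in_sets)
  then interpret finite_measure_subalgebra ?M "info_algebra S g t"
    by unfold_locales
  have I: "?I \<in> info_algebra S g t \<rightarrow>\<^sub>M ?A"
    unfolding info_algebra_def by (rule measurable_vimage_algebra1) (auto intro: measurable_space)
  have "AE \<omega> in ?M. real_cond_exp ?M (info_algebra S g t) (total_cost t) \<omega> = j (?I \<omega>)"
  proof (rule real_cond_exp_charact)
    fix b assume "b \<in> sets (info_algebra S g t)"
    then obtain a where a[measurable]: "a \<in> sets ?A" and b: "b = ?I -` a \<inter> space ?M"
      using measurable_space[OF run_measurable(2)[OF t]] unfolding info_algebra_def
      by (subst (asm) sets_vimage_algebra2) auto
    have "(\<integral>\<omega>\<in>b. total_cost t \<omega> \<partial>?M) = (\<integral>\<omega>. indicator a (?I \<omega>) * total_cost t \<omega> \<partial>?M)"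
      unfolding set_lebesgue_integral_def
      by (rule Bochner_Integration.integral_cong) (auto simp: b indicator_def)
    also have "\<dots> = (\<integral>\<omega>. indicator a (?I \<omega>) * j (?I \<omega>) \<partial>?M)"
      unfolding eq[OF a] info_law_def by (rule integral_distr) measurable
    also have "\<dots> = (\<integral>\<omega>\<in>b. j (?I \<omega>) \<partial>?M)"
      unfolding set_lebesgue_integral_def
      by (rule Bochner_Integration.integral_cong) (auto simp: b indicator_def)
    finally show "(\<integral>\<omega>\<in>b. total_cost t \<omega> \<partial>?M) = (\<integral>\<omega>\<in>b. j (?I \<omega>) \<partial>?M)" .
  next
    show "integrable ?M (\<lambda>\<omega>. j (?I \<omega>))"
      using j(2) unfolding info_law_def by (subst (asm) integrable_distr_eq) auto
    show "(\<lambda>\<omega>. j (?I \<omega>)) \<in> borel_measurable (info_algebra S g t)"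
      by (rule measurable_compose[OF I j(1)])
  qed (rule C)
  then show ?thesis by (simp add: cost_to_go_def total_cost_def[abs_def])
qed

end

theorem theorem2:
  fixes S :: "('a, 'x, 'u, 'y, 'w, 'z) team"
    and \<rho> :: "nat \<Rightarrow> ('y, 'u) info \<Rightarrow> 'x \<Rightarrow> ennreal"
    and V :: "nat \<Rightarrow> ('x \<Rightarrow> ennreal) \<Rightarrow> ereal"
    and g :: "('y, 'u) strategy"
    and t :: nat
  assumes team: "delayed_sharing_team S"
    and info_state: "information_state S \<rho>"
    and V_final: "\<And>\<pi>. V (horizon S) \<pi> =
        ext_expectation (density (state_space S (horizon S)) \<pi>) (\<lambda>x. ereal (final_cost S x))"
    and V_step: "\<And>s \<pi>. s < horizon S \<Longrightarrow> V s \<pi> =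
        (INF u\<in>space (controls S s).
           ext_expectation (step_law S s \<pi> u)
             (\<lambda>(x, y). ereal (stage_cost S s x u) + V (Suc s) (update S s \<pi> y u)))"
    and strategy: "g \<in> strategies S"
    and time: "t \<le> horizon S"
    and integrable_stage: "\<And>l. t \<le> l \<Longrightarrow> l < horizon S \<Longrightarrow>
        integrable (sample S) (\<lambda>\<omega>. stage_cost S l (state S g l \<omega>) (control S g l \<omega>))"
    and integrable_final:
        "integrable (sample S) (\<lambda>\<omega>. final_cost S (state S g (horizon S) \<omega>))"
  shows "AE \<omega> in sample S. V t (\<rho> t (info S g t \<omega>)) \<le> ereal (cost_to_go S g t \<omega>)"
proof -
  interpret closed_loop S \<rho> g
    by unfold_locales (fact team info_state strategy)+
  from value_le_cost[OF V_final V_step integrable_stage integrable_final time]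
  obtain j where j: "j \<in> borel_measurable (info_space S t)" "integrable (info_law t) j"
    "AE i in info_law t. V t (\<rho> t i) \<le> ereal (j i)"
    "\<And>a. a \<in> sets (info_space S t) \<Longrightarrow>
       (\<integral>\<omega>. indicator a (info S g t \<omega>) * total_cost t \<omega> \<partial>sample S) = (\<integral>i. indicator a i * j i \<partial>info_law t)"
    by blast
  have "integrable (sample S) (total_cost t)"
    unfolding total_cost_def[abs_def] using integrable_stage integrable_final
    by (intro Bochner_Integration.integrable_add Bochner_Integration.integrable_sum) auto
  then have "AE \<omega> in sample S. cost_to_go S g t \<omega> = j (info S g t \<omega>)"
    by (rule cost_to_go_charact[OF time j(1,2)]) (rule j(4))
  \<comment> \<open>A statement almost everywhere under the law of the information passes to the
    sample space whether or not \<open>V\<close> is measurable.\<close>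
  with AE_distrD[OF run_measurable(2)[OF time] j(3)[unfolded info_law_def]]
  show ?thesis by eventually_elim simp
qed

end
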